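(* Let $(X,d)$ be a metric space, let $k\ge 1$ be an integer, let $E\subset\mathbb{R}^k$ be (Lebesgue) measurable, and let $f:E\to X$ be a Lipschitz mapping. Then the following statements are equivalent: (1) $\mathcal{H}^k(f(E))=0$; (2) for any Lipschitz mapping $\varphi:X\to\mathbb{R}^k$, we have $\mathcal{H}^k(\varphi(f(E)))=0$; (3) for any collection of distinct points $\{y_1,y_2,\dots,y_k\}\subset X$, the associated projection $g:E\to\mathbb{R}^k$ of $f$ satisfies $\mathcal{H}^k(g(E))=0$; (4) for any collection of distinct points $\{y_1,y_2,\dots,y_k\}\subset X$, the associated projection $g:E\to\mathbb{R}^k$ of $f$ satisfies $\operatorname{rank}(\operatorname{ap}Dg(x))<k$ for $\mathcal{H}^k$-a.e. $x\in E$.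
   Context: $\mathcal{H}^k$ denotes the $k$-dimensional Hausdorff measure (on $\mathbb{R}^k$ it is the Lebesgue measure). Given $f:E\to X$ and points $y_1,\dots,y_k\in X$, the projection of $f$ associated with $y_1,\dots,y_k$ is the mapping $g:E\to\mathbb{R}^k$, $g(x)=(d(f(x),y_1),\dots,d(f(x),y_k))$. A measurable function $h:E\to\mathbb{R}$ on a measurable set $E\subset\mathbb{R}^k$ is approximately differentiable at $x\in E$ if there are a measurable set $E_x\subset E$ and a linear function $L:\mathbb{R}^k\to\mathbb{R}$ such that $x$ is a density point of $E_x$ and $\lim_{E_x\ni y\to x}\frac{h(y)-h(x)-L(y-x)}{|y-x|}=0$. The map $L$ is unique if it exists and is denoted $\operatorname{ap}Dh(x)$. For mappings into $\mathbb{R}^k$ approximate differentiability is understood componentwise, and $\operatorname{ap}Dg(x)$ is the linear map (matrix) whose components are the approximate derivatives of the components. Lipschitz mappings $E\to\mathbb{R}^k$ are approximately differentiable a.e. in $E$. *)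

theory Defs
  imports "HOL-Analysis.Analysis"
begin

text \<open>
  Hausdorff measure, as an outer measure on arbitrary subsets of a metric space, with the
  normalisation \<open>\<omega>\<^sub>k (diam/2)\<^sup>k\<close> under which it agrees with Lebesgue measure on
  \<open>\<real>\<^sup>k\<close>. The empty set is given weight 0 explicitly because \<open>0 ^ 0 = 1\<close>.
\<close>

definition hausdorff_weight :: "nat \<Rightarrow> 'a::metric_space set \<Rightarrow> ennreal" where
  "hausdorff_weight k S =
     (if S = {} then 0 else ennreal (unit_ball_vol (real k) * (diameter S / 2) ^ k))"

text \<open>
  Boundedness is required separately since \<^const>\<open>diameter\<close> is real-valued and carries no
  information on unbounded sets. If no countable cover exists, the infimum is \<open>\<infinity>\<close>.
\<close>

definition hausdorff_covers :: "real \<Rightarrow> 'a::metric_space set \<Rightarrow> (nat \<Rightarrow> 'a set) set" where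
  "hausdorff_covers \<delta> A =
     {C. A \<subseteq> (\<Union>i. C i) \<and> (\<forall>i. bounded (C i) \<and> diameter (C i) \<le> \<delta>)}"

definition hausdorff_content :: "nat \<Rightarrow> real \<Rightarrow> 'a::metric_space set \<Rightarrow> ennreal" where
  "hausdorff_content k \<delta> A = (INF C\<in>hausdorff_covers \<delta> A. \<Sum>i. hausdorff_weight k (C i))"

definition hausdorff_measure :: "nat \<Rightarrow> 'a::metric_space set \<Rightarrow> ennreal" where
  "hausdorff_measure k A = (SUP \<delta>\<in>{0<..}. hausdorff_content k \<delta> A)"

definition projection_at :: "('k::finite \<Rightarrow> 'a::metric_space) \<Rightarrow> ('b \<Rightarrow> 'a) \<Rightarrow> 'b \<Rightarrow> real ^ 'k" where
  "projection_at y f x = (\<chi> i. dist (f x) (y i))"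

definition density_point :: "'n::euclidean_space \<Rightarrow> 'n set \<Rightarrow> bool" where
  "density_point x S \<longleftrightarrow>
     ((\<lambda>r. measure lebesgue (S \<inter> ball x r) / measure lebesgue (ball x r)) \<longlongrightarrow> 1) (at_right 0)"

text \<open>
  Intended for \<open>E\<close> Lebesgue measurable and \<open>h\<close> measurable on \<open>E\<close>; \<open>x\<close> need not lie in
  \<open>Ex\<close>. Since \<open>x\<close> is a density point of \<open>Ex\<close>, the filter \<open>at x within Ex\<close> is nontrivial and
  \<open>L\<close> is unique, so \<open>ap_deriv\<close> below is meaningful wherever such an \<open>L\<close> exists.
\<close>

definition has_ap_derivative ::
    "'n::euclidean_space set \<Rightarrow> ('n \<Rightarrow> real) \<Rightarrow> 'n \<Rightarrow> ('n \<Rightarrow> real) \<Rightarrow> bool" where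
  "has_ap_derivative E h x L \<longleftrightarrow>
     x \<in> E \<and> linear L \<and>
     (\<exists>Ex. Ex \<in> sets lebesgue \<and> Ex \<subseteq> E \<and> density_point x Ex \<and>
        ((\<lambda>y. (h y - h x - L (y - x)) / norm (y - x)) \<longlongrightarrow> 0) (at x within Ex))"

definition ap_deriv ::
    "'n::euclidean_space set \<Rightarrow> ('n \<Rightarrow> real) \<Rightarrow> 'n \<Rightarrow> 'n \<Rightarrow> real" where
  "ap_deriv E h x = (THE L. has_ap_derivative E h x L)"

definition ap_differentiable ::
    "'n::euclidean_space set \<Rightarrow> ('n \<Rightarrow> real ^ 'm) \<Rightarrow> 'n \<Rightarrow> bool" where
  "ap_differentiable E g x \<longleftrightarrow> (\<forall>i. \<exists>L. has_ap_derivative E (\<lambda>y. g y $ i) x L)"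

definition ap_jacobian ::
    "(real ^ 'n::finite) set \<Rightarrow> (real ^ 'n \<Rightarrow> real ^ 'm::finite) \<Rightarrow> real ^ 'n \<Rightarrow> real ^ 'n ^ 'm" where
  "ap_jacobian E g x = matrix (\<lambda>v. \<chi> i. ap_deriv E (\<lambda>y. g y $ i) x v)"

end

theory Submission
  imports Defs
begin

text \<open>
  The implications from (1) to (2) to (3) hold because Lipschitz maps preserve null sets for the
  Hausdorff measure. For (3) to (4), extend the projection to a Lipschitz map \<open>G\<close> on the whole
  space; by Rademacher's theorem its approximate derivative is the classical derivative of \<open>G\<close> at
  almost every point of \<open>E\<close>, and where that derivative is injective \<open>G\<close> locally expands distances
  by a definite factor, so a set of such points with null image is null.

  For (4) to (1), let \<open>z n\<close> be dense in \<open>f ` E\<close> and let \<open>F n\<close> be Lipschitz extensions of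
  \<open>dist (f x) (z n)\<close>; then the distance of \<open>f x\<close> and \<open>f y\<close> is the supremum over \<open>n\<close> of the
  differences of \<open>F n\<close>. If all \<open>k\<close>-tuples have degenerate derivatives at \<open>x\<close>, all the derivatives
  of the \<open>F n\<close> at \<open>x\<close> annihilate a common unit vector. A one-dimensional density argument makes the
  resulting smallness of difference quotients uniform in \<open>n\<close>, so that \<open>E\<close> is, up to a null set, a
  countable union of pieces on each of which \<open>f\<close> contracts by an arbitrarily small factor \<open>\<eta>\<close> in a
  fixed direction. The images of these pieces have total measure \<open>O(\<eta>)\<close>.
\<close>

section \<open>Hausdorff measure\<close>

text \<open>As \<open>X\<close> carries no linear structure, \<open>f\<close> has no derivative, and
  all information comes from the scalar functions \<open>dist (f x) z\<close>. Two obstacles shape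
  the last implication. Each of these functions is flat in the common kernel direction only below a
  scale of its own, while a bound for \<open>f\<close> needs one scale for all of them;
  differentiability cannot supply it, but the measure of a single set on lines can. Moreover the
  kernel direction varies with \<open>x\<close>, so it is replaced by one of countably many
  directions at the price of an error proportional to \<eta>, harmless because \<eta> is arbitrary.

  Only the vanishing of measures is at stake, so Hausdorff and Lebesgue measure are compared up to
  factors depending on the dimension: the 2 comes from enclosing a set in a ball, the 5 from
  Vitali's enlargement, and 10 and 50 are products of these losses.\<close>

lemma diameter_le_dist:
  fixes S :: "'a::metric_space set"
  assumes "0 \<le> d" "\<And>x y. x \<in> S \<Longrightarrow> y \<in> S \<Longrightarrow> dist x y \<le> d"
  shows "diameter S \<le> d"
  unfolding diameter_def using assms by (auto intro!: cSUP_least split: prod.split)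

lemma ennreal_two_power: "(2::ennreal) ^ n = ennreal (2 ^ n)"
  by (metis ennreal_numeral ennreal_power zero_le_numeral)

lemma hausdorff_content_le:
  assumes "A \<subseteq> (\<Union>i. C i)" "\<And>i. bounded (C i)" "\<And>i. diameter (C i) \<le> \<delta>"
  shows "hausdorff_content k \<delta> A \<le> (\<Sum>i. hausdorff_weight k (C i))"
  unfolding hausdorff_content_def
  by (rule INF_lower) (use assms in \<open>auto simp: hausdorff_covers_def\<close>)

lemma hausdorff_content_le_measure: "0 < \<delta> \<Longrightarrow> hausdorff_content k \<delta> A \<le> hausdorff_measure k A"
  unfolding hausdorff_measure_def by (rule SUP_upper) auto

lemma hausdorff_measure_le:
  "(\<And>\<delta>. 0 < \<delta> \<Longrightarrow> hausdorff_content k \<delta> A \<le> c) \<Longrightarrow> hausdorff_measure k A \<le> c"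
  unfolding hausdorff_measure_def by (rule SUP_least) auto

lemma hausdorff_content_less_cover:
  assumes "hausdorff_content k \<delta> A < c"
  obtains C where "A \<subseteq> (\<Union>i. C i)" "\<And>i. bounded (C i)" "\<And>i. diameter (C i) \<le> \<delta>"
    "(\<Sum>i. hausdorff_weight k (C i)) < c"
  using assms unfolding hausdorff_content_def INF_less_iff by (auto simp: hausdorff_covers_def)

lemma hausdorff_measure_mono:
  assumes "A \<subseteq> B" shows "hausdorff_measure k A \<le> hausdorff_measure k B"
  unfolding hausdorff_measure_def hausdorff_content_def
  by (rule SUP_mono, rule bexI, rule INF_mono) (use assms in \<open>auto simp: hausdorff_covers_def\<close>)

lemma hausdorff_content_countably_subadditive:
  fixes A :: "nat \<Rightarrow> 'a::metric_space set"
  shows "hausdorff_content k \<delta> (\<Union>n. A n) \<le> (\<Sum>n. hausdorff_content k \<delta> (A n))"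
\<comment> \<open>For an infinite content, adding \<open>?e n\<close> would not give a strict
  inequality, hence no cover.\<close>
proof (cases "\<exists>n. hausdorff_content k \<delta> (A n) = top")
  case True
  then obtain n where n: "hausdorff_content k \<delta> (A n) = top" by auto
  have "(\<Sum>n\<in>{n}. hausdorff_content k \<delta> (A n)) \<le> (\<Sum>n. hausdorff_content k \<delta> (A n))"
    by (intro sum_le_suminf) auto
  then show ?thesis using n by (simp add: top_unique)
next
  case False
  show ?thesis
  proof (rule ennreal_le_epsilon)
    fix e :: real assume "0 < e"
    let ?e = "\<lambda>n::nat. ennreal (e * (1/2) ^ Suc n)"
    have "\<exists>C. A n \<subseteq> (\<Union>i. C i) \<and> (\<forall>i. bounded (C i) \<and> diameter (C i) \<le> \<delta>) \<and>
        (\<Sum>i. hausdorff_weight k (C i)) \<le> hausdorff_content k \<delta> (A n) + ?e n" for n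
    proof -
      have "hausdorff_content k \<delta> (A n) < hausdorff_content k \<delta> (A n) + ?e n"
        using False \<open>0 < e\<close> ennreal_add_left_cancel_less[of "hausdorff_content k \<delta> (A n)" 0 "?e n"]
        by simp
      then show ?thesis
        by (rule hausdorff_content_less_cover) (metis less_imp_le)
    qed
    then obtain C where C: "\<And>n. A n \<subseteq> (\<Union>i. C n i)" "\<And>n i. bounded (C n i)"
      "\<And>n i. diameter (C n i) \<le> \<delta>"
      "\<And>n. (\<Sum>i. hausdorff_weight k (C n i)) \<le> hausdorff_content k \<delta> (A n) + ?e n"
      by metis
    let ?D = "\<lambda>i. case prod_decode i of (m, n) \<Rightarrow> C m n"
    have "(\<Union>n. A n) \<subseteq> (\<Union>i. ?D i)"
    proof
      fix x assume "x \<in> (\<Union>n. A n)"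
      then obtain m n where "x \<in> C m n" using C(1) by blast
      then show "x \<in> (\<Union>i. ?D i)" by (intro UN_I[of "prod_encode (m, n)"]) auto
    qed
    then have "hausdorff_content k \<delta> (\<Union>n. A n) \<le> (\<Sum>i. hausdorff_weight k (?D i))"
      by (rule hausdorff_content_le) (auto simp: C split: prod.split)
    also have "\<dots> = (\<Sum>i. (\<lambda>(m, n). hausdorff_weight k (C m n)) (prod_decode i))"
      by (simp add: case_prod_unfold)
    also have "\<dots> = (\<Sum>m. \<Sum>n. hausdorff_weight k (C m n))"
      by (rule suminf_ennreal_2dimen) simp
    also have "\<dots> \<le> (\<Sum>n. hausdorff_content k \<delta> (A n) + ?e n)"
      by (intro suminf_le C) auto
    also have "\<dots> = (\<Sum>n. hausdorff_content k \<delta> (A n)) + (\<Sum>n. ?e n)"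
      by (rule suminf_add[symmetric]) auto
    also have "(\<Sum>n. ?e n) = ennreal e"
    proof (rule suminf_ennreal_eq)
      show "(\<lambda>n. e * (1/2) ^ Suc n) sums e"
        using sums_mult[OF power_half_series, of e] by simp
    qed (use \<open>0 < e\<close> in auto)
    finally show "hausdorff_content k \<delta> (\<Union>n. A n) \<le> (\<Sum>n. hausdorff_content k \<delta> (A n)) + ennreal e" .
  qed
qed

lemma hausdorff_measure_countably_subadditive:
  fixes A :: "nat \<Rightarrow> 'a::metric_space set"
  shows "hausdorff_measure k (\<Union>n. A n) \<le> (\<Sum>n. hausdorff_measure k (A n))"
proof (rule hausdorff_measure_le)
  fix \<delta> :: real assume "0 < \<delta>"
  then have "(\<Sum>n. hausdorff_content k \<delta> (A n)) \<le> (\<Sum>n. hausdorff_measure k (A n))"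
    by (intro suminf_le hausdorff_content_le_measure) auto
  then show "hausdorff_content k \<delta> (\<Union>n. A n) \<le> (\<Sum>n. hausdorff_measure k (A n))"
    using hausdorff_content_countably_subadditive order_trans by blast
qed

lemma hausdorff_measure_Un:
  fixes A B :: "'a::metric_space set"
  shows
  "hausdorff_measure k (A \<union> B) \<le> hausdorff_measure k A + hausdorff_measure k B"
proof -
  have [simp]: "hausdorff_measure k ({} :: 'a set) = 0"
  proof (intro antisym hausdorff_measure_le)
    fix \<delta> :: real assume "0 < \<delta>"
    then show "hausdorff_content k \<delta> ({} :: 'a set) \<le> 0"
      using hausdorff_content_le[of "{}" "\<lambda>_. {}" \<delta> k] by (simp add: hausdorff_weight_def)
  qed simp
  let ?A = "\<lambda>n::nat. if n = 0 then A else if n = 1 then B else {}"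
  have "?A 0 \<union> ?A 1 \<subseteq> (\<Union>n. ?A n)" by blast
  then have "A \<union> B \<subseteq> (\<Union>n. ?A n)" by simp
  then have "hausdorff_measure k (A \<union> B) \<le> (\<Sum>n. hausdorff_measure k (?A n))"
    by (rule order_trans[OF hausdorff_measure_mono hausdorff_measure_countably_subadditive])
  also have "\<dots> = (\<Sum>n\<in>{0,1}. hausdorff_measure k (?A n))"
    by (rule suminf_finite) auto
  finally show ?thesis by simp
qed

section \<open>Hausdorff measure of Lipschitz images\<close>

lemma hausdorff_measure_lipschitz_image_eq_0:
  fixes \<phi> :: "'a::metric_space \<Rightarrow> 'b::metric_space"
  assumes "C-lipschitz_on S \<phi>" "hausdorff_measure k S = 0"
  shows "hausdorff_measure k (\<phi> ` S) = 0"
proof -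
  \<comment> \<open>\<open>C\<close> may vanish; \<open>K\<close> is positive, so scales and weights
    can be divided by it.\<close>
  define K where "K = C + 1"
  have K: "0 < K" "K-lipschitz_on S \<phi>"
    using assms(1) lipschitz_on_nonneg[OF assms(1)] by (auto simp: K_def intro: lipschitz_on_mono)
  have "hausdorff_content k \<delta> (\<phi> ` S) \<le> 0 + ennreal e" if "0 < \<delta>" "0 < e" for \<delta> e :: real
  proof -
    \<comment> \<open>Scale \<open>\<delta> / K\<close> and tolerance \<open>e / K ^ k\<close>
      become \<open>\<delta>\<close> and \<open>e\<close> under a map that stretches diameters by at
      most \<open>K\<close>.\<close>
    have "hausdorff_content k (\<delta> / K) S < ennreal (e / K ^ k)"
      using hausdorff_content_le_measure[of "\<delta> / K" k S] assms(2) that K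
      by (auto simp: order.strict_trans1)
    then obtain D where D: "S \<subseteq> (\<Union>i. D i)" "\<And>i. bounded (D i)" "\<And>i. diameter (D i) \<le> \<delta> / K"
      "(\<Sum>i. hausdorff_weight k (D i)) < ennreal (e / K ^ k)"
      by (rule hausdorff_content_less_cover) blast
    have dist: "dist (\<phi> x) (\<phi> y) \<le> K * diameter (D i)" if "x \<in> S \<inter> D i" "y \<in> S \<inter> D i" for x y i
    proof -
      have "dist (\<phi> x) (\<phi> y) \<le> K * dist x y" using lipschitz_onD[OF K(2)] that by auto
      also have "\<dots> \<le> K * diameter (D i)"
        using that K(1) by (intro mult_left_mono diameter_bounded_bound D) auto
      finally show ?thesis .
    qed
    have bd: "bounded (\<phi> ` (S \<inter> D i))" for i
      unfolding bounded_two_points using dist by fastforce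
    have dm: "diameter (\<phi> ` (S \<inter> D i)) \<le> K * diameter (D i)" for i
      by (rule diameter_le_dist) (use dist K(1) diameter_ge_0[OF D(2)] in auto)
    have "hausdorff_content k \<delta> (\<phi> ` S) \<le> (\<Sum>i. hausdorff_weight k (\<phi> ` (S \<inter> D i)))"
    proof (rule hausdorff_content_le)
      show "diameter (\<phi> ` (S \<inter> D i)) \<le> \<delta>" for i
        using order_trans[OF dm] D(3)[of i] K(1) by (simp add: field_simps)
    next
      show "\<phi> ` S \<subseteq> (\<Union>i. \<phi> ` (S \<inter> D i))" using D(1) by blast
    qed (rule bd)
    also have "\<dots> \<le> (\<Sum>i. ennreal (K ^ k) * hausdorff_weight k (D i))"
    proof (intro suminf_le)
      fix i
      show "hausdorff_weight k (\<phi> ` (S \<inter> D i)) \<le> ennreal (K ^ k) * hausdorff_weight k (D i)"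
      proof (cases "S \<inter> D i = {}")
        case False
        have "(diameter (\<phi> ` (S \<inter> D i)) / 2) ^ k \<le> (K * diameter (D i) / 2) ^ k"
          using dm[of i] diameter_ge_0[OF bd[of i]] by (intro power_mono) auto
        moreover have "(K * diameter (D i) / 2) ^ k = K ^ k * (diameter (D i) / 2) ^ k"
          by (metis power_mult_distrib times_divide_eq_right)
        ultimately have "unit_ball_vol k * (diameter (\<phi> ` (S \<inter> D i)) / 2) ^ k
            \<le> unit_ball_vol k * (K ^ k * (diameter (D i) / 2) ^ k)"
          by (intro mult_left_mono) auto
        then have "unit_ball_vol k * (diameter (\<phi> ` (S \<inter> D i)) / 2) ^ k
            \<le> K ^ k * (unit_ball_vol k * (diameter (D i) / 2) ^ k)"
          by (simp only: mult.left_commute)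
        then show ?thesis
          using False K(1) by (auto simp: hausdorff_weight_def ennreal_mult'[symmetric] intro!: ennreal_leI)
      qed (auto simp: hausdorff_weight_def)
    qed auto
    also have "\<dots> = ennreal (K ^ k) * (\<Sum>i. hausdorff_weight k (D i))" by simp
    also have "\<dots> \<le> ennreal (K ^ k) * ennreal (e / K ^ k)"
      using D(4) by (intro mult_left_mono) auto
    also have "\<dots> = ennreal e" using K(1) that by (simp add: ennreal_mult'[symmetric])
    finally show ?thesis by simp
  qed
  then have "hausdorff_measure k (\<phi> ` S) \<le> 0"
    by (rule hausdorff_measure_le[OF ennreal_le_epsilon]) auto
  then show ?thesis by simp
qed

text \<open>Vitali's covering lemma gives disjoint balls inside \<open>U\<close> whose fivefold
  enlargements cover \<open>S\<close>. The image of an enlarged ball of radius \<open>5 * r\<close>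
  has diameter at most \<open>10 * C * r\<close>, hence weight at most
  \<open>(5 * C) ^ DIM('n)\<close> times the volume of the small ball, and these volumes add up to
  at most that of \<open>U\<close>. The Lipschitz bound is asked only at distances below
  \<open>\<rho>\<close>, which is all that the pieces of the later decomposition offer.\<close>

lemma hausdorff_measure_local_lipschitz_image_le:
  fixes f :: "'n::euclidean_space \<Rightarrow> 'a::metric_space"
  assumes U: "open U" "S \<subseteq> U" and \<rho>: "0 < \<rho>" "0 \<le> C"
    and lip: "\<And>x y. x \<in> S \<Longrightarrow> y \<in> S \<Longrightarrow> dist x y < \<rho> \<Longrightarrow> dist (f x) (f y) \<le> C * dist x y"
  shows "hausdorff_measure DIM('n) (f ` S) \<le> ennreal ((5 * C) ^ DIM('n)) * emeasure lborel U"
proof (rule hausdorff_measure_le)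
  fix \<delta> :: real assume "0 < \<delta>"
  \<comment> \<open>\<open>10 * B < \<rho>\<close> puts two points of an enlarged ball within reach
    of \<open>lip\<close>, with 11 in place of 10 for strictness;
    \<open>10 * C * B \<le> \<delta>\<close> bounds the diameters of the images, with
    \<open>C + 1\<close> guarding against \<open>C = 0\<close>.\<close>
  define B where "B = min (\<rho> / 11) (\<delta> / (10 * (C + 1)))"
  have B: "0 < B" "10 * B < \<rho>" "10 * C * B \<le> \<delta>"
  proof -
    show "0 < B" using \<rho> \<open>0 < \<delta>\<close> by (auto simp: B_def)
    have "B \<le> \<rho> / 11" unfolding B_def by (rule min.cobounded1)
    then show "10 * B < \<rho>" using \<rho> by simp
    have "C * B \<le> (C + 1) * (\<delta> / (10 * (C + 1)))"
      using \<rho> \<open>0 < B\<close> \<open>0 < \<delta>\<close> by (intro mult_mono) (auto simp only: B_def min.cobounded2)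
    also have "\<dots> = \<delta> / 10" using \<rho> by (simp add: field_simps)
    finally show "10 * C * B \<le> \<delta>" by simp
  qed
  have "\<exists>r. 0 < r \<and> r \<le> B \<and> cball x r \<subseteq> U" if x: "x \<in> S" for x
  proof -
    obtain e where "0 < e" "cball x e \<subseteq> U" using U x open_contains_cball by blast
    then show ?thesis using B(1) by (intro exI[of _ "min e B"]) auto
  qed
  then obtain r where r: "\<And>x. x \<in> S \<Longrightarrow> 0 < r x \<and> r x \<le> B \<and> cball x (r x) \<subseteq> U" by metis
  have "S \<subseteq> (\<Union>x\<in>S. cball x (r x))"
  proof
    fix x assume "x \<in> S" then show "x \<in> (\<Union>x\<in>S. cball x (r x))"
      using r[of x] by (intro UN_I[of x]) auto
  qed
  then obtain I where I: "countable I" "I \<subseteq> S"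
    "pairwise (\<lambda>i j. disjnt (cball i (r i)) (cball j (r j))) I"
    "S \<subseteq> (\<Union>x\<in>I. cball x (5 * r x))"
    by (rule Vitali_covering_lemma_cballs[where r = r and B = B]) (use r in auto)
  \<comment> \<open>Covers are indexed by all naturals: the countable set \<open>I\<close> of
    centres is numbered, and the remaining indices get the empty set, of weight 0.\<close>
  define J where "J = to_nat_on I ` I"
  define p where "p = from_nat_into I"
  have p: "p (to_nat_on I x) = x" if "x \<in> I" for x using that I(1) by (simp add: p_def)
  have pJ: "p n \<in> I" if "n \<in> J" for n using that p by (auto simp: J_def)
  let ?D = "\<lambda>n. if n \<in> J then f ` (S \<inter> cball (p n) (5 * r (p n))) else {}"
  let ?B = "\<lambda>n. if n \<in> J then cball (p n) (r (p n)) else {}"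
  have dist: "dist (f x) (f y) \<le> 10 * C * r z"
    if "z \<in> I" "x \<in> S \<inter> cball z (5 * r z)" "y \<in> S \<inter> cball z (5 * r z)" for x y z
  proof -
    have "dist x y \<le> 10 * r z"
      using that dist_triangle2[of x y z] by (auto simp: dist_commute)
    moreover have "r z \<le> B" using r that I by auto
    ultimately have "dist (f x) (f y) \<le> C * dist x y" using B(2) that by (intro lip) auto
    also have "\<dots> \<le> C * (10 * r z)" using \<open>dist x y \<le> 10 * r z\<close> \<rho> by (intro mult_left_mono)
    finally show ?thesis by simp
  qed
  have rI: "0 < r z" "r z \<le> B" "cball z (r z) \<subseteq> U" if "z \<in> I" for z using that r I by auto
  have bd: "bounded (f ` (S \<inter> cball z (5 * r z)))" if "z \<in> I" for z
    unfolding bounded_two_points using dist[OF that] by fastforce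
  have dm: "diameter (f ` (S \<inter> cball z (5 * r z))) \<le> 10 * C * r z" if "z \<in> I" for z
    by (rule diameter_le_dist) (use dist[OF that] rI[OF that] \<rho> in auto)
  have "hausdorff_content DIM('n) \<delta> (f ` S) \<le> (\<Sum>n. hausdorff_weight DIM('n) (?D n))"
  proof (rule hausdorff_content_le)
    show "f ` S \<subseteq> (\<Union>n. ?D n)"
    proof (rule image_subsetI)
      fix x assume "x \<in> S"
      then obtain z where "z \<in> I" "x \<in> cball z (5 * r z)" using I(4) by auto
      then have "f x \<in> ?D (to_nat_on I z)" using p \<open>x \<in> S\<close> by (auto simp: J_def)
      then show "f x \<in> (\<Union>n. ?D n)" by blast
    qed
    show "bounded (?D n)" for n using bd[OF pJ] by auto
    show "diameter (?D n) \<le> \<delta>" for n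
    proof (cases "n \<in> J")
      case True
      have "10 * C * r (p n) \<le> 10 * C * B" using rI[OF pJ[OF True]] \<rho> by (intro mult_left_mono) auto
      then show ?thesis using True dm[OF pJ[OF True]] B(3) by auto
    qed (use \<open>0 < \<delta>\<close> in auto)
  qed
  also have "\<dots> \<le> (\<Sum>n. ennreal ((5 * C) ^ DIM('n)) * emeasure lborel (?B n))"
  proof (intro suminf_le)
    fix n
    show "hausdorff_weight DIM('n) (?D n) \<le> ennreal ((5 * C) ^ DIM('n)) * emeasure lborel (?B n)"
    proof (cases "n \<in> J \<and> ?D n \<noteq> {}")
      case True
      then have z: "p n \<in> I" by (auto intro: pJ)
      have "(diameter (?D n) / 2) ^ DIM('n) \<le> (5 * C * r (p n)) ^ DIM('n)"
        using True dm[OF z] diameter_ge_0[OF bd[OF z]] by (intro power_mono) auto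
      then have "unit_ball_vol DIM('n) * (diameter (?D n) / 2) ^ DIM('n)
          \<le> (5 * C) ^ DIM('n) * (unit_ball_vol DIM('n) * r (p n) ^ DIM('n))"
        by (simp add: power_mult_distrib mult.left_commute mult_left_mono)
      then show ?thesis
        using True rI[OF z] \<rho>
        by (auto simp: hausdorff_weight_def emeasure_cball ennreal_mult'[symmetric] intro!: ennreal_leI)
    qed (auto simp: hausdorff_weight_def)
  qed auto
  also have "\<dots> = ennreal ((5 * C) ^ DIM('n)) * (\<Sum>n. emeasure lborel (?B n))"
    by simp
  also have "(\<Sum>n. emeasure lborel (?B n)) = emeasure lborel (\<Union>n. ?B n)"
  proof (rule suminf_emeasure)
    show "disjoint_family ?B"
      unfolding disjoint_family_on_def
    proof (intro ballI impI)
      fix m n :: nat assume "m \<noteq> n"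
      show "?B m \<inter> ?B n = {}"
      proof (cases "m \<in> J \<and> n \<in> J")
        case True
        then obtain x y where "x \<in> I" "y \<in> I" "m = to_nat_on I x" "n = to_nat_on I y"
          by (auto simp: J_def)
        moreover from this have "disjnt (cball x (r x)) (cball y (r y))"
          using \<open>m \<noteq> n\<close> by (intro pairwiseD[OF I(3)]) auto
        ultimately show ?thesis using True p by (simp add: disjnt_def)
      qed auto
    qed
  qed auto
  also have "emeasure lborel (\<Union>n. ?B n) \<le> emeasure lborel U"
    using U(1) rI(3) pJ by (intro emeasure_mono) (auto split: if_splits)
  finally show "hausdorff_content DIM('n) \<delta> (f ` S) \<le> ennreal ((5 * C) ^ DIM('n)) * emeasure lborel U"
    by (simp add: mult_left_mono)
qed

section \<open>Comparison with Lebesgue measure\<close>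

text \<open>A nonempty bounded set lies in the ball about any of its points whose radius is its
  diameter, and that ball has volume \<open>2 ^ DIM('n)\<close> times the weight of the set. The
  bound is independent of the mesh of the cover, so the content at scale 1 suffices.\<close>

lemma hausdorff_measure_less_outer:
  fixes S :: "'n::euclidean_space set"
  assumes "hausdorff_measure DIM('n) S < c"
  obtains T where "T \<in> sets borel" "S \<subseteq> T" "emeasure lborel T \<le> 2 ^ DIM('n) * c"
proof -
  have "hausdorff_content DIM('n) 1 S < c"
    using assms hausdorff_content_le_measure[of 1 "DIM('n)" S] by auto
  then obtain C where C: "S \<subseteq> (\<Union>i. C i)" "\<And>i. bounded (C i)" "\<And>i. diameter (C i) \<le> 1"
    "(\<Sum>i. hausdorff_weight DIM('n) (C i)) < c"
    by (rule hausdorff_content_less_cover) blast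
  define T where "T i = (if C i = {} then {} else cball (SOME x. x \<in> C i) (diameter (C i)))" for i
  have sub: "C i \<subseteq> T i" for i
    using diameter_bounded_bound[OF C(2)] some_in_eq[of "C i"] by (auto simp: T_def)
  have T: "T i \<in> sets borel" for i by (auto simp: T_def)
  have "emeasure lborel (T i) \<le> 2 ^ DIM('n) * hausdorff_weight DIM('n) (C i)" for i
    using diameter_ge_0[OF C(2)]
    by (auto simp: T_def hausdorff_weight_def emeasure_cball power_divide ennreal_two_power ennreal_mult'[symmetric])
  then have "(\<Sum>i. emeasure lborel (T i)) \<le> (\<Sum>i. 2 ^ DIM('n) * hausdorff_weight DIM('n) (C i))"
    by (intro suminf_le) auto
  also have "\<dots> \<le> 2 ^ DIM('n) * c" using C(4) by (auto intro!: mult_left_mono)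
  finally have "emeasure lborel (\<Union>i. T i) \<le> 2 ^ DIM('n) * c"
    using emeasure_subadditive_countably[of T lborel] T by (simp add: image_subset_iff order_trans)
  moreover have "S \<subseteq> (\<Union>i. T i)" using C(1) sub by blast
  ultimately show thesis using T by (intro that[of "\<Union>i. T i"]) auto
qed

text \<open>The covering bound above is applied to an open superset of \<open>S\<close> of small
  volume; \<open>\<rho> = 1\<close> is arbitrary, as \<open>f\<close> is Lipschitz on
  \<open>S\<close> at every distance.\<close>

lemma hausdorff_measure_lipschitz_image_negligible:
  fixes f :: "'n::euclidean_space \<Rightarrow> 'a::metric_space"
  assumes "C-lipschitz_on S f" "negligible S"
  shows "hausdorff_measure DIM('n) (f ` S) = 0"
proof -
  define K where "K = (5 * C) ^ DIM('n) + 1"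
  have C: "0 \<le> C" using lipschitz_on_nonneg assms(1) by blast
  then have K: "0 < K" by (simp add: K_def add_nonneg_pos)
  have "hausdorff_measure DIM('n) (f ` S) \<le> 0 + ennreal e" if "0 < e" for e
  proof -
    have "S \<in> sets lebesgue" using assms(2) negligible_imp_sets by blast
    moreover have "0 < e / K" using that K by simp
    ultimately obtain U where U: "open U" "S \<subseteq> U" "U - S \<in> lmeasurable" 
      "emeasure lebesgue (U - S) < ennreal (e / K)"
      by (rule sets_lebesgue_outer_open)
    have "emeasure lborel U = emeasure lebesgue ((U - S) \<union> S)"
      using U(1,2) by (simp add: Un_absorb2)
    also have "\<dots> = emeasure lebesgue (U - S)"
      using assms(2) U(3) by (intro emeasure_Un_null_set) (auto simp: negligible_iff_null_sets)
    finally have eU: "emeasure lborel U \<le> ennreal (e / K)" using U(4) by simp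
    have "hausdorff_measure DIM('n) (f ` S) \<le> ennreal ((5 * C) ^ DIM('n)) * emeasure lborel U"
      using lipschitz_onD[OF assms(1)] U(1,2) C
      by (intro hausdorff_measure_local_lipschitz_image_le[of _ _ 1]) auto
    also have "\<dots> \<le> ennreal K * ennreal (e / K)"
      by (intro mult_mono eU) (auto simp: K_def intro: ennreal_leI)
    also have "\<dots> = ennreal e" using K that by (simp add: ennreal_mult'[symmetric])
    finally show ?thesis by simp
  qed
  then have "hausdorff_measure DIM('n) (f ` S) \<le> 0" by (rule ennreal_le_epsilon) auto
  then show ?thesis by simp
qed

lemma hausdorff_measure_eq_0_iff_negligible:
  fixes S :: "'n::euclidean_space set"
  shows "hausdorff_measure DIM('n) S = 0 \<longleftrightarrow> negligible S"
proof
  assume 0: "hausdorff_measure DIM('n) S = 0"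
  show "negligible S"
    unfolding negligible_outer_le
  proof (intro allI impI)
    fix e :: real assume "0 < e"
    have "hausdorff_measure DIM('n) S < ennreal (e / 2 ^ DIM('n))" using 0 \<open>0 < e\<close> by simp
    then obtain T where T: "T \<in> sets borel" "S \<subseteq> T"
      "emeasure lborel T \<le> 2 ^ DIM('n) * ennreal (e / 2 ^ DIM('n))"
      by (rule hausdorff_measure_less_outer)
    have "2 ^ DIM('n) * ennreal (e / 2 ^ DIM('n)) = ennreal e"
      using \<open>0 < e\<close> by (simp add: ennreal_two_power ennreal_mult'[symmetric])
    then have eT: "emeasure lebesgue T \<le> ennreal e" using T by simp
    then have "T \<in> lmeasurable"
      using T(1) order.strict_trans1[OF eT ennreal_less_top] by (intro fmeasurableI) auto
    moreover have "measure lebesgue T \<le> e"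
      using eT \<open>0 < e\<close> by (auto simp: measure_def intro: enn2real_leI)
    ultimately show "\<exists>T. S \<subseteq> T \<and> T \<in> lmeasurable \<and> measure lebesgue T \<le> e"
      using T(2) by blast
  qed
next
  assume "negligible S"
  then show "hausdorff_measure DIM('n) S = 0"
    using hausdorff_measure_lipschitz_image_negligible[OF lipschitz_on_id] by fastforce
qed

section \<open>Lebesgue density\<close>

text \<open>Lebesgue's density theorem from Vitali's covering theorem: about a point of
  \<open>N j\<close> there are arbitrarily small balls of which a definite fraction misses
  \<open>A\<close>. Disjoint such balls inside an open set \<open>T\<close> barely larger than
  \<open>A \<inter> B\<close> cover \<open>N j\<close> up to a null set, while their parts outside
  \<open>A\<close> fit into the small set \<open>T - A \<inter> B\<close>.\<close>

lemma negligible_non_density_points: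
  fixes A :: "'n::euclidean_space set"
  assumes A: "A \<in> sets lebesgue"
  shows "negligible {x \<in> A. \<not> density_point x A}"
proof -
  let ?m = "measure lebesgue"
  define N where "N j = {x \<in> A \<inter> ball 0 (Suc j). \<forall>d>0. \<exists>r. 0 < r \<and> r < d \<and>
      ?m (A \<inter> ball x r) < (1 - 1 / Suc j) * ?m (ball x r)}" for j :: nat
  have split: "?m (ball x r) = ?m (A \<inter> ball x r) + ?m (ball x r - A)" for x r
  proof -
    have "A \<inter> ball x r \<in> lmeasurable"
      using fmeasurable_Int_fmeasurable[OF lmeasurable_ball A] by (simp add: Int_commute)
    then have "?m (ball x r - A \<inter> ball x r) = ?m (ball x r) - ?m (A \<inter> ball x r)"
      by (intro measurable_measure_Diff) auto
    moreover have "ball x r - A \<inter> ball x r = ball x r - A" by auto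
    ultimately show ?thesis by simp
  qed
  have neg: "negligible (N j)" for j
    unfolding negligible_outer_le
  proof (intro allI impI)
    fix e :: real assume "0 < e"
    define c where "c = real (Suc j)"
    have c: "0 < c" by (simp add: c_def)
    define B where "B = ball (0::'n) (Suc j)"
    \<comment> \<open>The tolerance \<open>e / c\<close> absorbs the factor \<open>c\<close> by
      which \<open>le\<close> below bounds a ball by its part outside \<open>A\<close>.\<close>
    have "A \<inter> B \<in> sets lebesgue" "0 < e / c" using A \<open>0 < e\<close> c by (auto simp: B_def)
    then obtain T where T: "open T" "A \<inter> B \<subseteq> T" "T - A \<inter> B \<in> lmeasurable"
      "emeasure lebesgue (T - A \<inter> B) < ennreal (e / c)"
      by (rule sets_lebesgue_outer_open)
    define K where "K = {(x, r). x \<in> N j \<and> 0 < r \<and> ball x r \<subseteq> T \<inter> B \<and>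
      ?m (A \<inter> ball x r) < (1 - 1 / c) * ?m (ball x r)}"
    have "\<exists>i. i \<in> K \<and> x \<in> ball (fst i) (snd i) \<and> snd i < d" if xd: "x \<in> N j" "0 < d" for x d
    proof -
      have "x \<in> T \<inter> B" "open (T \<inter> B)" using that T by (auto simp: N_def B_def)
      then obtain d' where d': "0 < d'" "ball x d' \<subseteq> T \<inter> B" using open_contains_ball by blast
      obtain r where r: "0 < r" "r < min d d'" "?m (A \<inter> ball x r) < (1 - 1 / c) * ?m (ball x r)"
      proof -
        have "\<forall>d>0. \<exists>r. 0 < r \<and> r < d \<and> ?m (A \<inter> ball x r) < (1 - 1 / c) * ?m (ball x r)"
          using xd(1) unfolding N_def c_def by blast
        moreover have "0 < min d d'" using xd d' by simp
        ultimately show thesis using that by blast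
      qed
      then have "ball x r \<subseteq> T \<inter> B" using d' by (meson min.strict_boundedE less_imp_le order_trans subset_ball)
      then show ?thesis using r that by (intro exI[of _ "(x, r)"]) (auto simp: K_def)
    qed
    then obtain C where C: "countable C" "C \<subseteq> K"
      "pairwise (\<lambda>i j. disjnt (ball (fst i) (snd i)) (ball (fst j) (snd j))) C"
      "negligible (N j - (\<Union>i\<in>C. ball (fst i) (snd i)))"
      by (rule Vitali_covering_theorem_balls) blast
    let ?B = "\<lambda>i. ball (fst i) (snd i) :: 'n set"
    define W where "W = (\<Union>i\<in>C. ?B i)"
    have disj: "disjoint_family_on ?B C"
      using C(3) by (auto simp: disjoint_family_on_def pairwise_def disjnt_def)
    then have disj': "disjoint_family_on (\<lambda>i. ?B i - A) C"
      unfolding disjoint_family_on_def by blast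
    have le: "emeasure lebesgue (?B i) \<le> ennreal c * emeasure lebesgue (?B i - A)" if "i \<in> C" for i
    proof -
      have "?m (A \<inter> ?B i) < (1 - 1 / c) * ?m (?B i)" using that C(2) by (auto simp: K_def)
      then have "?m (?B i) \<le> c * ?m (?B i - A)"
        using split[of "fst i" "snd i"] c by (simp add: field_simps)
      then have "ennreal (?m (?B i)) \<le> ennreal c * ennreal (?m (?B i - A))"
        using c by (simp add: ennreal_mult'[symmetric] ennreal_leI)
      moreover have "?B i \<in> lmeasurable" "?B i - A \<in> lmeasurable"
        using A by (auto intro: fmeasurable_Diff)
      ultimately show ?thesis by (simp only: emeasure_eq_measure2)
    qed
    have "emeasure lebesgue W = (\<integral>\<^sup>+ i. emeasure lebesgue (?B i) \<partial>count_space C)"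
      unfolding W_def by (rule emeasure_UN_countable) (use C(1) disj in auto)
    also have "\<dots> \<le> (\<integral>\<^sup>+ i. ennreal c * emeasure lebesgue (?B i - A) \<partial>count_space C)"
      by (intro nn_integral_mono) (use le in auto)
    also have "\<dots> = ennreal c * (\<integral>\<^sup>+ i. emeasure lebesgue (?B i - A) \<partial>count_space C)"
      by (rule nn_integral_cmult) auto
    also have "(\<integral>\<^sup>+ i. emeasure lebesgue (?B i - A) \<partial>count_space C) = emeasure lebesgue (\<Union>i\<in>C. ?B i - A)"
      by (rule emeasure_UN_countable[symmetric])
        (use C(1) A disj' in auto)
    also have "\<dots> \<le> emeasure lebesgue (T - A \<inter> B)"
    proof (rule emeasure_mono)
      have "?B i \<subseteq> T" if "i \<in> C" for i
      proof -
        have "i \<in> K" using that C(2) by blast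
        then show ?thesis unfolding K_def by (cases i) simp
      qed
      then show "(\<Union>i\<in>C. ?B i - A) \<subseteq> T - A \<inter> B" by blast
    qed (use T(3) in auto)
    also have "\<dots> \<le> ennreal (e / c)" using T(4) by simp
    finally have "emeasure lebesgue W \<le> ennreal c * ennreal (e / c)" by (simp add: mult_left_mono)
    also have "\<dots> = ennreal e" using c \<open>0 < e\<close> by (simp add: ennreal_mult'[symmetric])
    finally have W: "emeasure lebesgue W \<le> ennreal e" .
    \<comment> \<open>Measurability of \<open>N j\<close> has not been established; the enclosing
      set is \<open>W\<close> together with the null remainder \<open>N j - W\<close>.\<close>
    have "open W" by (auto simp: W_def)
    then have "emeasure lebesgue (W \<union> (N j - W)) = emeasure lebesgue W"
      using C(4) by (intro emeasure_Un_null_set) (auto simp: negligible_iff_null_sets W_def)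
    with W have W': "emeasure lebesgue (W \<union> (N j - W)) \<le> ennreal e" by simp
    moreover have "W \<union> (N j - W) \<in> sets lebesgue"
    proof (rule sets.Un)
      show "W \<in> sets lebesgue" using \<open>open W\<close> by simp
      show "N j - W \<in> sets lebesgue" using C(4) negligible_imp_sets by (simp add: W_def)
    qed
    ultimately have "W \<union> (N j - W) \<in> lmeasurable"
      using order.strict_trans1[OF W' ennreal_less_top] by (intro fmeasurableI) auto
    moreover have "?m (W \<union> (N j - W)) \<le> e"
      using W' \<open>0 < e\<close> by (auto simp: measure_def intro: enn2real_leI)
    ultimately show "\<exists>T. N j \<subseteq> T \<and> T \<in> lmeasurable \<and> ?m T \<le> e"
      by (intro exI[of _ "W \<union> (N j - W)"]) auto
  qed
  have "{x \<in> A. \<not> density_point x A} \<subseteq> (\<Union>j. N j)"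
  proof
    fix x assume "x \<in> {x \<in> A. \<not> density_point x A}"
    then have x: "x \<in> A" "\<not> density_point x A" by auto
    let ?q = "\<lambda>r. ?m (A \<inter> ball x r) / ?m (ball x r)"
    obtain e where e: "0 < e" "\<not> eventually (\<lambda>r. dist (?q r) 1 < e) (at_right 0)"
      using x(2) unfolding density_point_def tendsto_iff by auto
    have q1: "?q r \<le> 1" if "0 < r" for r
      using split[of x r] content_ball_pos[OF that, of x] by (simp add: divide_le_eq)
    obtain j where j: "1 / Suc j < e" "norm x < Suc j"
    proof -
      obtain n1 :: nat where "1 / e < n1" using reals_Archimedean2 by blast
      obtain n2 :: nat where "norm x < n2" using reals_Archimedean2 by blast
      have "1 / Suc (n1 + n2) < e" using \<open>1 / e < n1\<close> e(1)
        by (simp add: field_simps) (smt (verit) mult_nonneg_nonneg of_nat_0_le_iff)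
      then show thesis using \<open>norm x < n2\<close> by (intro that[of "n1 + n2"]) auto
    qed
    have "\<exists>r. 0 < r \<and> r < d \<and> ?m (A \<inter> ball x r) < (1 - 1 / Suc j) * ?m (ball x r)" if d: "0 < d" for d
    proof -
      obtain r where r: "0 < r" "r < d" "\<not> dist (?q r) 1 < e"
        using e(2) d unfolding eventually_at_right_field by blast
      then have "?q r \<le> 1 - e" using q1[of r] by (auto simp: dist_real_def)
      also have "\<dots> < 1 - 1 / Suc j" using j by simp
      finally have "?m (A \<inter> ball x r) < (1 - 1 / Suc j) * ?m (ball x r)"
        using content_ball_pos[OF r(1), of x] by (simp add: divide_less_eq)
      then show ?thesis using r by blast
    qed
    then have "x \<in> N j" using x(1) j(2) by (auto simp: N_def)
    then show "x \<in> (\<Union>j. N j)" by blast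
  qed
  moreover have "negligible (\<Union>j. N j)" by (intro negligible_countable_Union) (auto simp: neg)
  ultimately show ?thesis using negligible_subset by blast
qed

text \<open>Otherwise \<open>A\<close> would miss a ball of radius
  \<open>\<epsilon> * dist p x\<close> about \<open>p\<close>. It lies in the ball of radius
  \<open>(1 + \<epsilon>) * dist p x\<close> about \<open>x\<close> and fills the fraction
  \<open>c\<close> of it, which density forbids at small scales. This converts measure into nearby
  points, both for slopes and for the uniqueness of approximate derivatives.\<close>

lemma density_point_nonporous:
  fixes x :: "'n::euclidean_space"
  assumes x: "density_point x A" and A: "A \<in> sets lebesgue" and "0 < \<epsilon>"
  obtains \<delta> where "0 < \<delta>"
    "\<And>p. p \<noteq> x \<Longrightarrow> dist p x < \<delta> \<Longrightarrow> \<exists>y\<in>A. dist y p \<le> \<epsilon> * dist p x"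
proof -
  let ?m = "measure lebesgue"
  define c where "c = (\<epsilon> / (1 + \<epsilon>)) ^ DIM('n)"
  have c: "0 < c" using \<open>0 < \<epsilon>\<close> by (simp add: c_def)
  then have "eventually (\<lambda>r. dist (?m (A \<inter> ball x r) / ?m (ball x r)) 1 < c) (at_right 0)"
    using x by (auto simp: density_point_def tendsto_iff)
  then obtain d where d: "0 < d"
    "\<And>r. 0 < r \<Longrightarrow> r < d \<Longrightarrow> dist (?m (A \<inter> ball x r) / ?m (ball x r)) 1 < c"
    unfolding eventually_at_right_field by auto
  show thesis
  proof
    show "0 < d / (1 + \<epsilon>)" using d \<open>0 < \<epsilon>\<close> by simp
    fix p assume p: "p \<noteq> x" "dist p x < d / (1 + \<epsilon>)"
    define R where "R = (1 + \<epsilon>) * dist p x"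
    have R: "0 < R" "R < d" using p \<open>0 < \<epsilon>\<close>
      by (auto simp: R_def field_simps intro!: add_pos_pos)
    show "\<exists>y\<in>A. dist y p \<le> \<epsilon> * dist p x"
    proof (rule ccontr)
      assume "\<not> ?thesis"
      then have disj: "A \<inter> ball p (\<epsilon> * dist p x) = {}" by (force simp: dist_commute)
      have sub: "ball p (\<epsilon> * dist p x) \<subseteq> ball x R"
      proof
        fix z assume "z \<in> ball p (\<epsilon> * dist p x)"
        then show "z \<in> ball x R" using dist_triangle[of x z p]
          by (auto simp: R_def algebra_simps dist_commute)
      qed
      have "?m (A \<inter> ball x R) \<le> ?m (ball x R - ball p (\<epsilon> * dist p x))"
        using disj by (intro measure_mono_fmeasurable) (use A in auto)
      also have "\<dots> = ?m (ball x R) - ?m (ball p (\<epsilon> * dist p x))"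
        by (rule measurable_measure_Diff) (use sub in auto)
      also have "?m (ball p (\<epsilon> * dist p x)) = c * ?m (ball x R)"
        using R \<open>0 < \<epsilon>\<close> by (simp add: content_ball c_def R_def power_divide power_mult_distrib)
      finally have "?m (A \<inter> ball x R) / ?m (ball x R) \<le> 1 - c"
        using content_ball_pos[OF R(1), of x] by (subst pos_divide_le_eq) (auto simp: algebra_simps)
      then show False using d(2)[OF R] by (auto simp: dist_real_def)
    qed
  qed
qed

section \<open>Null sets and parallel lines\<close>

text \<open>Integrate the indicator of \<open>N\<close> at \<open>x + t *\<^sub>R v\<close> over all
  \<open>x\<close> and all real \<open>t\<close>. Translation invariance gives the measure of
  \<open>N\<close> times the infinite length of the line; Fubini gives the integral of the lengths
  of the line sections, which vanish.\<close>

lemma null_set_of_null_on_lines: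
  fixes N :: "'n::euclidean_space set"
  assumes N[measurable]: "N \<in> sets borel"
    and null: "\<And>x. {t. x + t *\<^sub>R v \<in> N} \<in> null_sets lborel"
  shows "N \<in> null_sets lborel"
proof -
  have *: "(\<integral>\<^sup>+ x. indicator N (x + t *\<^sub>R v) \<partial>lborel) = emeasure lborel N" for t
  proof -
    have "emeasure lborel N = (\<integral>\<^sup>+ x. indicator N x \<partial>distr lborel borel ((+) (t *\<^sub>R v)))"
      by (simp add: lborel_distr_plus)
    also have "\<dots> = (\<integral>\<^sup>+ x. indicator N (t *\<^sub>R v + x) \<partial>lborel)"
      by (rule nn_integral_distr) auto
    finally show ?thesis by (simp add: add.commute)
  qed
  have "(\<integral>\<^sup>+ t. \<integral>\<^sup>+ x. indicator N (x + t *\<^sub>R v) \<partial>lborel \<partial>lborel)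
      = (\<integral>\<^sup>+ x. \<integral>\<^sup>+ t. indicator N (x + t *\<^sub>R v) \<partial>lborel \<partial>lborel)"
    by (rule lborel_pair.Fubini') simp
  also have "\<dots> = (\<integral>\<^sup>+ x. emeasure lborel {t. x + t *\<^sub>R v \<in> N} \<partial>lborel)"
  proof (intro nn_integral_cong)
    fix x
    have "(\<integral>\<^sup>+ t. indicator N (x + t *\<^sub>R v) \<partial>lborel) = (\<integral>\<^sup>+ t. indicator {t. x + t *\<^sub>R v \<in> N} t \<partial>lborel)"
      by (intro nn_integral_cong) (auto simp: indicator_def)
    also have "\<dots> = emeasure lborel {t. x + t *\<^sub>R v \<in> N}"
      using null[of x] by (intro nn_integral_indicator) auto
    finally show "(\<integral>\<^sup>+ t. indicator N (x + t *\<^sub>R v) \<partial>lborel) = emeasure lborel {t. x + t *\<^sub>R v \<in> N}" .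
  qed
  also have "\<dots> = 0" using null by (simp add: null_sets_def)
  finally have "emeasure lborel N * emeasure lborel (UNIV :: real set) = 0"
    by (simp add: *)
  then show ?thesis by (auto simp: null_sets_def)
qed

section \<open>Lipschitz functions of one real variable\<close>

text \<open>After tilting by a small slope \<open>e\<close>, take the last point of the interval
  where \<open>h\<close> is still nonpositive; if it came before \<open>b\<close>, the slope
  hypothesis there would carry the inequality further to the right.\<close>

lemma nonincreasing_of_right_upper_slope_le_0:
  fixes \<psi> :: "real \<Rightarrow> real"
  assumes cont: "continuous_on {a..b} \<psi>" and "a \<le> b"
    and slope: "\<And>t e. a \<le> t \<Longrightarrow> t < b \<Longrightarrow> 0 < e \<Longrightarrow>
      eventually (\<lambda>s. \<psi> s - \<psi> t \<le> e * (s - t)) (at_right t)"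
  shows "\<psi> b \<le> \<psi> a"
proof (rule field_le_epsilon)
  fix e' :: real assume "0 < e'"
  define e where "e = e' / (b - a + 1)"
  have e: "0 < e" "e * (b - a) \<le> e'"
    using \<open>0 < e'\<close> \<open>a \<le> b\<close> by (auto simp: e_def divide_simps intro: mult_left_mono)
  define h where "h t = \<psi> t - \<psi> a - e * (t - a)" for t
  have ch: "continuous_on {a..b} h" unfolding h_def by (intro continuous_intros cont)
  define S where "S = {t \<in> {a..b}. h t \<le> 0}"
  have "closed S"
    unfolding S_def by (intro continuous_on_closed_Collect_le ch continuous_intros closed_atLeastAtMost)
  moreover have "bounded S" by (rule bounded_subset[of "{a..b}"]) (auto simp: S_def)
  ultimately have "compact S" by (simp add: compact_eq_bounded_closed)
  moreover have "a \<in> S" using \<open>a \<le> b\<close> by (auto simp: S_def h_def)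
  ultimately obtain t where t: "t \<in> S" "\<And>s. s \<in> S \<Longrightarrow> s \<le> t"
    using compact_attains_sup[of S] by blast
  have "t = b"
  proof (rule ccontr)
    assume "t \<noteq> b"
    with t have tb: "a \<le> t" "t < b" "h t \<le> 0" by (auto simp: S_def)
    obtain d where d: "t < d" "\<And>s. t < s \<Longrightarrow> s < d \<Longrightarrow> \<psi> s - \<psi> t \<le> e * (s - t)"
      using slope[OF tb(1,2) e(1)] unfolding eventually_at_right_field by blast
    obtain s where s: "t < s" "s < min d b" using dense[of t "min d b"] d tb by auto
    then have "h s \<le> 0" using d(2)[of s] tb by (auto simp: h_def algebra_simps)
    then have "s \<in> S" using s tb by (auto simp: S_def)
    then show False using t(2) s by fastforce
  qed
  then show "\<psi> b \<le> \<psi> a + e'" using t(1) e by (auto simp: S_def h_def)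
qed

text \<open>The part of the interval outside \<open>A\<close> is enclosed in an open set
  \<open>T\<close> of nearly the same measure, and the length of \<open>T\<close> is accumulated in
  \<open>u\<close>. At a point of \<open>A\<close> the slope hypothesis bounds the growth of
  \<open>f\<close>, and \<open>u\<close> can only help. Any other point has a neighbourhood inside
  \<open>T\<close>, where \<open>u\<close> grows at rate 1 and \<open>L * u\<close> pays for the
  Lipschitz growth of \<open>f\<close>. So \<open>\<psi>\<close> has nonpositive upper right slope
  throughout.\<close>

lemma increment_le_of_right_upper_slope_le:
  fixes f :: "real \<Rightarrow> real"
  assumes lip: "L-lipschitz_on {a..b} f" and "a \<le> b" and "0 \<le> \<eta>" and A: "A \<in> sets lebesgue"
    and slope: "\<And>t e. t \<in> A \<Longrightarrow> a \<le> t \<Longrightarrow> t < b \<Longrightarrow> 0 < e \<Longrightarrow>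
      eventually (\<lambda>s. f s - f t \<le> (\<eta> + e) * (s - t)) (at_right t)"
  shows "f b - f a \<le> \<eta> * (b - a) + L * measure lebesgue ({a..b} - A)"
proof (rule field_le_epsilon)
  fix e :: real assume "0 < e"
  let ?m = "measure lebesgue"
  have L: "0 \<le> L" using lip lipschitz_on_nonneg by blast
  define e' where "e' = e / (L + 1)"
  have e': "0 < e'" "L * e' \<le> e"
    using \<open>0 < e\<close> L by (auto simp: e'_def divide_simps algebra_simps)
  have AB: "{a..b} - A \<in> sets lebesgue" "{a..b} - A \<in> lmeasurable"
    using A by (auto intro: fmeasurable_Diff)
  obtain T where T: "open T" "{a..b} - A \<subseteq> T" "T - ({a..b} - A) \<in> lmeasurable"
    "emeasure lebesgue (T - ({a..b} - A)) < ennreal e'"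
    using sets_lebesgue_outer_open[OF AB(1) e'(1)] by metis
  define u where "u s = ?m (T \<inter> {a..s})" for s
  have meas: "T \<inter> {c..d} \<in> lmeasurable" for c d
    using T(1) fmeasurable_Int_fmeasurable[of "{c..d}" lebesgue T] by (simp add: Int_commute)
  have u_diff: "u s - u t = ?m (T \<inter> {t<..s})" if "a \<le> t" "t \<le> s" for s t
  proof -
    have "?m ((T \<inter> {a..s}) - (T \<inter> {a..t})) = u s - u t"
      unfolding u_def by (rule measurable_measure_Diff) (use that meas in auto)
    moreover have "(T \<inter> {a..s}) - (T \<inter> {a..t}) = T \<inter> {t<..s}" using that by auto
    ultimately show ?thesis by simp
  qed
  have u_mono: "0 \<le> u s - u t" if "a \<le> t" "t \<le> s" for s t
    using u_diff[OF that] by simp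
  have u_le: "u s - u t \<le> s - t" if "a \<le> t" "t \<le> s" for s t
  proof -
    have "?m (T \<inter> {t<..s}) \<le> ?m {t<..s}"
      by (intro measure_mono_fmeasurable) (use T(1) in \<open>auto intro: bounded_set_imp_lmeasurable\<close>)
    then show ?thesis using u_diff[OF that] that by simp
  qed
  have cu: "continuous_on {a..b} u"
  proof (rule lipschitz_on_continuous_on)
    show "1-lipschitz_on {a..b} u"
    proof (rule lipschitz_on_leI)
      fix x y assume "x \<in> {a..b}" "y \<in> {a..b}" "x \<le> y"
      then show "dist (u x) (u y) \<le> 1 * dist x y"
        using u_le[of x y] u_mono[of x y] by (auto simp: dist_real_def)
    qed simp
  qed
  define \<psi> where "\<psi> s = f s - \<eta> * (s - a) - L * u s" for s
  have "\<psi> b \<le> \<psi> a"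
  proof (rule nonincreasing_of_right_upper_slope_le_0[where \<psi> = \<psi>])
    show "continuous_on {a..b} \<psi>"
      unfolding \<psi>_def by (intro continuous_intros cu lipschitz_on_continuous_on[OF lip])
    fix t d :: real assume t: "a \<le> t" "t < b" "0 < d"
    show "eventually (\<lambda>s. \<psi> s - \<psi> t \<le> d * (s - t)) (at_right t)"
    proof (cases "t \<in> A")
      case True
      show ?thesis
        using slope[OF True t] eventually_at_right_less
      proof eventually_elim
        case (elim s)
        then have "0 \<le> L * (u s - u t)" using u_mono t L by simp
        then show ?case using elim by (simp add: \<psi>_def algebra_simps)
      qed
    next
      case False
      then have "t \<in> T" using T(2) t by auto
      then obtain r where r: "0 < r" "ball t r \<subseteq> T" using T(1) open_contains_ball by blast
      have "eventually (\<lambda>s. t < s \<and> s < min b (t + r)) (at_right t)"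
        using t r by (auto simp: eventually_at_right_field intro!: exI[of _ "min b (t + r)"])
      then show ?thesis
      proof eventually_elim
        case (elim s)
        have "T \<inter> {t<..s} = {t<..s}" using r elim by (force simp: dist_real_def)
        then have us: "u s - u t = s - t" using u_diff[of t s] elim t by simp
        have "f s - f t \<le> L * (s - t)"
          using lipschitz_onD[OF lip, of s t] elim t by (auto simp: dist_real_def)
        then have "f s - f t - L * (u s - u t) \<le> 0" by (simp add: us)
        moreover have "0 \<le> (\<eta> + d) * (s - t)" using elim t \<open>0 \<le> \<eta>\<close> by simp
        ultimately show ?case by (simp add: \<psi>_def algebra_simps)
      qed
    qed
  qed fact
  then have "f b - f a \<le> \<eta> * (b - a) + L * (u b - u a)"
    using \<open>a \<le> b\<close> by (simp add: \<psi>_def algebra_simps)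
  also have "u b - u a \<le> ?m ({a..b} - A) + e'"
  proof -
    have "u b - u a \<le> u b" by (simp add: u_def)
    also have "u b \<le> ?m (({a..b} - A) \<union> (T - ({a..b} - A)))"
      unfolding u_def
    proof (rule measure_mono_fmeasurable)
      show "{a..b} - A \<union> (T - ({a..b} - A)) \<in> lmeasurable"
        by (rule fmeasurable.Un[OF AB(2) T(3)])
    qed (use meas in auto)
    also have "\<dots> \<le> ?m ({a..b} - A) + ?m (T - ({a..b} - A))"
      using AB T by (intro measure_Un_le) auto
    also have "?m (T - ({a..b} - A)) \<le> e'"
      using T(4) e' by (auto simp: measure_def intro!: enn2real_leI)
    finally show ?thesis by simp
  qed
  finally have "f b - f a \<le> \<eta> * (b - a) + L * (?m ({a..b} - A) + e')"
    using L by (simp add: mult_left_mono)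
  then show "f b - f a \<le> \<eta> * (b - a) + L * ?m ({a..b} - A) + e"
    using e'(2) by (simp add: algebra_simps)
qed

text \<open>Riesz's rising sun argument: the running minimum of \<open>f t - p * t\<close> is locally constant to
  the right of every point of \<open>A\<close>.\<close>

lemma increment_le_of_right_lower_slope_less:
  fixes f :: "real \<Rightarrow> real"
  assumes lip: "L-lipschitz_on UNIV f" and "a \<le> b" and A: "A \<in> sets lebesgue"
    and slope: "\<And>t. t \<in> A \<Longrightarrow> frequently (\<lambda>s. f s - f t < p * (s - t)) (at_right t)"
  shows "f b - f a \<le> p * (b - a) + (L + \<bar>p\<bar>) * measure lebesgue ({a..b} - A)"
proof -
  define g where "g t = f t - p * t" for t
  define K where "K = L + \<bar>p\<bar>"
  have L: "0 \<le> L" using lip lipschitz_on_nonneg by blast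
  have "\<bar>p\<bar>-lipschitz_on UNIV ((*) p)"
    by (rule lipschitz_onI) (auto simp: dist_real_def abs_mult simp flip: right_diff_distrib)
  then have g: "K-lipschitz_on UNIV g"
    unfolding g_def K_def by (intro lipschitz_on_diff lip) 
  then have cg: "continuous_on {t..b} g" for t
    using lipschitz_on_continuous_on continuous_on_subset by blast
  define M where "M t = Inf (g ` {t..b})" for t
  have M: "\<exists>x\<in>{t..b}. M t = g x \<and> (\<forall>y\<in>{t..b}. g x \<le> g y)" if "t \<le> b" for t
  proof -
    obtain x where x: "x \<in> {t..b}" "\<forall>y\<in>{t..b}. g x \<le> g y"
      using continuous_attains_inf[OF compact_Icc _ cg, of t] \<open>t \<le> b\<close> by auto
    then have "M t = g x" unfolding M_def by (intro cInf_eq_minimum) auto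
    with x show ?thesis by blast
  qed
  have M_le: "M t \<le> g y" if "t \<le> y" "y \<le> b" for t y
    using M[of t] that by force
  have M_mono: "M t \<le> M s" if "t \<le> s" "s \<le> b" for s t
    using M[of s] M_le[of t] that by force
  have M_lip: "M s - M t \<le> K * (s - t)" if "t \<le> s" "s \<le> b" for s t
  proof -
    have "t \<le> b" using that by simp
    from M[OF this] obtain x where x: "x \<in> {t..b}" "M t = g x" by blast
    show ?thesis
    proof (cases "s \<le> x")
      case True
      then have "M s \<le> M t" using x M_le[of s x] by simp
      moreover have "0 \<le> K * (s - t)" using L that by (simp add: K_def)
      ultimately show ?thesis by simp
    next
      case False
      have "M s \<le> g s" using M_le that by simp
      also have "g s \<le> g x + K * (s - x)"
        using lipschitz_onD[OF g, of s x] False by (auto simp: dist_real_def)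
      also have "\<dots> \<le> M t + K * (s - t)"
        using x L by (auto simp: K_def intro!: mult_left_mono)
      finally show ?thesis by simp
    qed
  qed
  \<comment> \<open>On \<open>A\<close> the upper right slope of \<open>M\<close> is at most 0, so
    only the complement contributes, at rate \<open>K\<close>.\<close>
  have "M b - M a \<le> 0 * (b - a) + K * measure lebesgue ({a..b} - A)"
  proof (rule increment_le_of_right_upper_slope_le[where f = M, OF _ \<open>a \<le> b\<close> order_refl A])
    show "K-lipschitz_on {a..b} M"
    proof (rule lipschitz_on_leI)
      fix x y assume "x \<in> {a..b}" "y \<in> {a..b}" "x \<le> y"
      then show "dist (M x) (M y) \<le> K * dist x y"
        using M_lip[of x y] M_mono[of x y] by (auto simp: dist_real_def)
    qed (use L in \<open>simp add: K_def\<close>)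
    fix t e :: real assume t: "t \<in> A" "a \<le> t" "t < b" "0 < e"
    have "eventually (\<lambda>s. s < b) (at_right t)"
      using t by (auto simp: eventually_at_right_field)
    then have "frequently (\<lambda>s. (f s - f t < p * (s - t)) \<and> s < b \<and> t < s) (at_right t)"
      using slope[OF t(1)] eventually_at_right_less[of t]
      by (auto intro: frequently_eventually_frequently eventually_conj)
    then obtain s where "f s - f t < p * (s - t)" "s < b" "t < s"
      using frequently_ex by blast
    then have s: "g s < g t" "t < s" "s < b" by (auto simp: g_def algebra_simps)
    have "isCont g t" using lipschitz_on_continuous_on[OF g] by (simp add: continuous_on_eq_continuous_at)
    then have "eventually (\<lambda>x. g s < g x) (at t)"
      using s(1) by (auto simp: isCont_def dest: order_tendstoD)
    then obtain r where "0 < r" "\<forall>x. x \<noteq> t \<and> dist x t < r \<longrightarrow> g s < g x"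
      unfolding eventually_at by auto
    then have r: "0 < r" "\<And>x. dist x t < r \<Longrightarrow> g s < g x"
      using s(1) by auto
    have "eventually (\<lambda>x. t < x \<and> x < min s (t + r)) (at_right t)"
      using s r by (auto simp: eventually_at_right_field intro!: exI[of _ "min s (t + r)"])
    then show "eventually (\<lambda>x. M x - M t \<le> (0 + e) * (x - t)) (at_right t)"
    proof eventually_elim
      case (elim x)
      obtain y where y: "y \<in> {t..b}" "M t = g y" "\<forall>z\<in>{t..b}. g y \<le> g z"
        using M[of t] t by auto
      \<comment> \<open>Between \<open>t\<close> and \<open>x\<close> the function \<open>g\<close>
        exceeds \<open>g s\<close>, so its minimum over \<open>{t..b}\<close> is attained at or
        beyond \<open>x\<close> and is still available to \<open>M x\<close>.\<close>
      have "x \<le> y"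
      proof (rule ccontr)
        assume "\<not> x \<le> y"
        then have "g s < g y" using elim y(1) by (intro r) (auto simp: dist_real_def)
        moreover have "s \<in> {t..b}" using s by simp
        ultimately show False using y(3) by (simp add: not_le[symmetric])
      qed
      then have "M x \<le> M t" using y M_le[of x y] by simp
      moreover have "0 \<le> e * (x - t)" using elim t by simp
      ultimately show ?case by simp
    qed
  qed
  \<comment> \<open>At \<open>b\<close> the minimum is over one point, and at \<open>a\<close> it is
    at most \<open>g a\<close>; so the increment of \<open>g\<close> is at most that of
    \<open>M\<close>.\<close>
  moreover have "M b = g b" using M[of b] by auto
  moreover have "M a \<le> g a" using M_le \<open>a \<le> b\<close> by simp
  ultimately have "g b - g a \<le> K * measure lebesgue ({a..b} - A)" by simp
  then show ?thesis by (simp add: g_def K_def algebra_simps)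
qed

lemma density_point_real_interval:
  fixes t :: real
  assumes t: "density_point t A" and A: "A \<in> sets lebesgue" and "0 < e"
  obtains \<delta> where "0 < \<delta>" "\<And>s. 0 < s \<Longrightarrow> s < \<delta> \<Longrightarrow> measure lebesgue ({t-s..t+s} - A) \<le> e * s"
proof -
  let ?m = "measure lebesgue"
  \<comment> \<open>Half of \<open>e\<close>, since \<open>ball t s\<close> has length
    \<open>2 * s\<close>.\<close>
  have "eventually (\<lambda>r. dist (?m (A \<inter> ball t r) / ?m (ball t r)) 1 < e / 2) (at_right 0)"
    using t half_gt_zero[OF \<open>0 < e\<close>] unfolding density_point_def tendsto_iff by blast
  then obtain d where d: "0 < d"
    "\<And>r. 0 < r \<Longrightarrow> r < d \<Longrightarrow> dist (?m (A \<inter> ball t r) / ?m (ball t r)) 1 < e / 2"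
    unfolding eventually_at_right_field by auto
  show thesis
  proof
    fix s assume s: "0 < s" "s < d"
    have ball: "ball t s = {t-s<..<t+s}" by (auto simp: dist_real_def)
    have mb: "?m (ball t s) = 2 * s" using s by (simp add: ball)
    have "(1 - e / 2) * (2 * s) \<le> ?m (A \<inter> ball t s)"
      using d(2)[OF s] s unfolding mb by (auto simp: dist_real_def field_simps abs_less_iff)
    moreover have meas: "A \<inter> ball t s \<in> lmeasurable"
      using fmeasurable_Int_fmeasurable[OF lmeasurable_ball A] by (simp add: Int_commute)
    moreover have "?m ({t-s..t+s} - A \<inter> ball t s) = ?m {t-s..t+s} - ?m (A \<inter> ball t s)"
      by (rule measurable_measure_Diff) (use meas in \<open>auto simp: ball\<close>)
    moreover have "?m ({t-s..t+s} - A) \<le> ?m ({t-s..t+s} - A \<inter> ball t s)"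
      by (rule measure_mono_fmeasurable) (use A meas in \<open>auto intro: fmeasurable_Diff\<close>)
    ultimately show "?m ({t-s..t+s} - A) \<le> e * s" using s by (simp add: algebra_simps)
  qed fact
qed

text \<open>If on a set the lower right slope is below \<open>p\<close> and the upper one above
  \<open>q\<close>, with \<open>p < q\<close>, then near a density point of the set the increment
  over \<open>{t-s..t+s}\<close> is at most about \<open>2 * s * p\<close> and at least about
  \<open>2 * s * q\<close>. So the set has no density point and is null. One-sided derivatives are
  enough here, as nonporosity later makes them two-sided.\<close>

lemma lipschitz_real_right_derivative:
  fixes f :: "real \<Rightarrow> real"
  assumes lip: "L-lipschitz_on UNIV f"
  shows "negligible {t. \<not> (\<exists>d. \<forall>e>0. eventually (\<lambda>s. \<bar>f s - f t - d * (s - t)\<bar> \<le> e * (s - t)) (at_right t))}"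
proof -
  have L: "0 \<le> L" using lip lipschitz_on_nonneg by blast
  have cf: "continuous_on UNIV f" using lip lipschitz_on_continuous_on by blast
  define lower where "lower h p = {t. frequently (\<lambda>s. h s - h t < p * (s - t)) (at_right t)}"
    for h :: "real \<Rightarrow> real" and p
  \<comment> \<open>This form serves measurability: for continuous \<open>h\<close> the uncountable
    unions over \<open>r\<close> consist of open sets, and the intersection over \<open>n\<close> is
    countable.\<close>
  have lower_eq: "lower h p = (\<Inter>n::nat. \<Union>r\<in>{0<..<1 / Suc n}. {t. h (t + r) - h t < p * r})" for h p
  proof -
    have "t \<in> lower h p \<longleftrightarrow> (\<forall>n::nat. \<exists>r. 0 < r \<and> r < 1 / Suc n \<and> h (t + r) - h t < p * r)" for t
    proof
      assume t: "t \<in> lower h p"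
      show "\<forall>n::nat. \<exists>r. 0 < r \<and> r < 1 / Suc n \<and> h (t + r) - h t < p * r"
      proof
        fix n :: nat
        have "eventually (\<lambda>s. t < s \<and> s < t + 1 / Suc n) (at_right t)"
          by (auto simp: eventually_at_right_field intro!: exI[of _ "t + 1 / Suc n"])
        then have "frequently (\<lambda>s. (t < s \<and> s < t + 1 / Suc n) \<and> h s - h t < p * (s - t)) (at_right t)"
          using t unfolding lower_def
          by (auto dest: frequently_eventually_frequently simp: conj_commute)
        then obtain s where "t < s" "s < t + 1 / Suc n" "h s - h t < p * (s - t)"
          using frequently_ex by blast
        then show "\<exists>r. 0 < r \<and> r < 1 / Suc n \<and> h (t + r) - h t < p * r"
          by (intro exI[of _ "s - t"]) auto
      qed
    next
      assume *: "\<forall>n::nat. \<exists>r. 0 < r \<and> r < 1 / Suc n \<and> h (t + r) - h t < p * r"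
      show "t \<in> lower h p"
        unfolding lower_def frequently_def eventually_at_right_field mem_Collect_eq
      proof safe
        fix b assume b: "t < b" "\<forall>y>t. y < b \<longrightarrow> \<not> h y - h t < p * (y - t)"
        obtain n :: nat where n: "1 / Suc n < b - t" using b(1) nat_approx_posE[of "b - t"] by auto
        obtain r where r: "0 < r" "r < 1 / Suc n" "h (t + r) - h t < p * r" using * by blast
        then show False using b(2)[rule_format, of "t + r"] n by auto
      qed
    qed
    then show ?thesis by (simp add: set_eq_iff Bex_def conj_assoc)
  qed
  have lower_borel: "lower h p \<in> sets borel" if "continuous_on UNIV h" for h p
  proof -
    have "open (\<Union>r\<in>{0<..<1 / real (Suc n)}. {t. h (t + r) - h t < p * r})" for n
      by (intro open_UN ballI open_Collect_less continuous_intros continuous_on_compose2[OF that]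
          continuous_on_subset[OF that]) auto
    then show ?thesis unfolding lower_eq by (intro sets.countable_INT'' borel_open) auto
  qed
  define N where "N p q = lower f p \<inter> lower (\<lambda>t. - f t) (- q)" for p q
  have negN: "negligible (N p q)" if "p < q" for p q
  proof -
    have N: "N p q \<in> sets lebesgue"
      using lower_borel[OF cf] lower_borel[OF continuous_on_minus[OF cf]] by (auto simp: N_def)
    define K where "K = 2 * L + \<bar>p\<bar> + \<bar>q\<bar> + 1"
    have "\<not> density_point t (N p q)" for t
    proof
      assume t: "density_point t (N p q)"
      \<comment> \<open>With this \<open>e\<close> the error terms total at most
        \<open>s * (q - p)\<close>, half of the gap \<open>2 * s * (q - p)\<close> that they would
        have to bridge.\<close>
      define e where "e = (q - p) / K"
      have "0 < K" using L by (simp add: K_def)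
      then have "0 < e" using that by (simp add: e_def)
      obtain d where d: "0 < d" "\<And>s. 0 < s \<Longrightarrow> s < d \<Longrightarrow> measure lebesgue ({t-s..t+s} - N p q) \<le> e * s"
        using density_point_real_interval[OF t N \<open>0 < e\<close>] by metis
      define s where "s = d / 2"
      have s: "0 < s" "s < d" using d by (auto simp: s_def)
      define m where "m = measure lebesgue ({t-s..t+s} - N p q)"
      have "f (t + s) - f (t - s) \<le> p * ((t + s) - (t - s)) + (L + \<bar>p\<bar>) * m"
        unfolding m_def by (rule increment_le_of_right_lower_slope_less[OF lip _ N])
          (use s in \<open>auto simp: N_def lower_def\<close>)
      moreover have "- f (t + s) - (- f (t - s)) \<le> - q * ((t + s) - (t - s)) + (L + \<bar>- q\<bar>) * m"
        unfolding m_def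
        by (rule increment_le_of_right_lower_slope_less[OF _ _ N, where f = "\<lambda>t. - f t"])
          (use s lip in \<open>auto simp: N_def lower_def lipschitz_on_minus\<close>)
      ultimately have "2 * s * (q - p) \<le> (2 * L + \<bar>p\<bar> + \<bar>q\<bar>) * m" by (simp add: algebra_simps)
      also have "\<dots> \<le> K * (e * s)"
        using d(2)[OF s] L by (intro mult_mono) (auto simp: K_def m_def)
      also have "\<dots> = s * (q - p)" using \<open>0 < K\<close> by (simp add: e_def)
      finally show False using s that by simp
    qed
    then show ?thesis using negligible_non_density_points[OF N] by simp
  qed
  have "negligible (\<Union>(p, q)\<in>{(p, q). p \<in> \<rat> \<and> q \<in> \<rat> \<and> p < q}. N p q)"
  proof (rule negligible_countable_Union)
    have "countable (\<rat> \<times> \<rat> :: (real \<times> real) set)" by (simp add: countable_rat)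
    then show "countable ((\<lambda>(p, q). N p q) ` {(p, q). p \<in> \<rat> \<and> q \<in> \<rat> \<and> p < q})"
      by (intro countable_image) (auto elim!: countable_subset[rotated])
  qed (auto simp: negN)
  moreover have "\<exists>d. \<forall>e>0. eventually (\<lambda>s. \<bar>f s - f t - d * (s - t)\<bar> \<le> e * (s - t)) (at_right t)"
    if t: "\<And>p q. p \<in> \<rat> \<Longrightarrow> q \<in> \<rat> \<Longrightarrow> p < q \<Longrightarrow> t \<notin> N p q" for t
  proof -
    \<comment> \<open>The supremum \<open>d\<close> of \<open>P\<close> is the lower right Dini
      derivative of \<open>f\<close> at \<open>t\<close>.\<close>
    define P where "P = {p. eventually (\<lambda>s. p * (s - t) \<le> f s - f t) (at_right t)}"
    define d where "d = Sup P"
    have "- L \<in> P" unfolding P_def mem_Collect_eq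
      using eventually_at_right_less[of t]
    proof eventually_elim
      case (elim s)
      then show ?case using lipschitz_onD[OF lip, of s t] by (auto simp: dist_real_def)
    qed
    have ub: "p \<le> L" if "p \<in> P" for p
    proof -
      have "eventually (\<lambda>s. p * (s - t) \<le> f s - f t \<and> t < s) (at_right t)"
        using that eventually_at_right_less[of t] by (auto simp: P_def eventually_conj_iff)
      then obtain s where s: "p * (s - t) \<le> f s - f t" "t < s"
        using eventually_happens'[OF trivial_limit_at_right_real] by blast
      then have "\<bar>f s - f t\<bar> \<le> L * (s - t)"
        using lipschitz_onD[OF lip, of s t] by (auto simp: dist_real_def)
      with s have "p * (s - t) \<le> L * (s - t)" by linarith
      then show ?thesis using s by simp
    qed
    have bdd: "bdd_above P" using ub by (auto simp: bdd_above_def)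
    show ?thesis
    proof (intro exI[of _ d] allI impI)
      fix e :: real assume "0 < e"
      have "d - e < d" using \<open>0 < e\<close> by simp
      moreover have "P \<noteq> {}" using \<open>- L \<in> P\<close> by blast
      ultimately obtain p where p: "p \<in> P" "d - e < p"
        unfolding d_def using less_cSup_iff[OF _ bdd] by blast
      obtain p' where p': "p' \<in> \<rat>" "d < p'" "p' < d + e" using Rats_dense_in_real[of d "d + e"] \<open>0 < e\<close> by auto
      obtain q' where q': "q' \<in> \<rat>" "p' < q'" "q' < d + e" using Rats_dense_in_real[of p' "d + e"] p' by auto
      \<comment> \<open>The lower slope is below \<open>p'\<close>, and since \<open>t\<close>
        avoids \<open>N p' q'\<close>, the upper slope does not exceed \<open>q'\<close>. Two
        rationals are taken because \<open>N\<close> compares distinct bounds.\<close>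
      have "p' \<notin> P" using cSup_upper[OF _ bdd, of p'] p' by (auto simp: d_def)
      then have "t \<in> lower f p'" by (simp add: P_def lower_def not_eventually not_le)
      then have "t \<notin> lower (\<lambda>t. - f t) (- q')" using t[OF p'(1) q'(1,2)] by (simp add: N_def)
      then have "eventually (\<lambda>s. f s - f t \<le> q' * (s - t)) (at_right t)"
        by (simp add: lower_def not_frequently not_less algebra_simps)
      moreover have "eventually (\<lambda>s. p * (s - t) \<le> f s - f t) (at_right t)" using p by (simp add: P_def)
      ultimately show "eventually (\<lambda>s. \<bar>f s - f t - d * (s - t)\<bar> \<le> e * (s - t)) (at_right t)"
        using eventually_at_right_less[of t]
      proof eventually_elim
        case (elim s)
        have "q' * (s - t) \<le> (d + e) * (s - t)" "(d - e) * (s - t) \<le> p * (s - t)"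
          using elim p q' by (auto intro: mult_right_mono)
        then show ?case using elim by (simp add: abs_le_iff algebra_simps)
      qed
    qed
  qed
  then have "{t. \<not> (\<exists>d. \<forall>e>0. eventually (\<lambda>s. \<bar>f s - f t - d * (s - t)\<bar> \<le> e * (s - t)) (at_right t))}
      \<subseteq> (\<Union>(p, q)\<in>{(p, q). p \<in> \<rat> \<and> q \<in> \<rat> \<and> p < q}. N p q)"
    by blast
  ultimately show ?thesis by (rule negligible_subset)
qed

section \<open>Rademacher's theorem and approximate derivatives\<close>

text \<open>The scale \<open>r\<close> and the error \<open>\<epsilon>\<close> are parameters so
  that the set is closed for continuous \<open>F\<close>; existence of a slope then becomes a
  countable combination of closed sets.\<close>

definition right_slope_set ::
    "('n::real_normed_vector \<Rightarrow> real) \<Rightarrow> 'n \<Rightarrow> real \<Rightarrow> real \<Rightarrow> real \<Rightarrow> 'n set" where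
  "right_slope_set F v q \<epsilon> r = {x. \<forall>h\<in>{0<..<r}. \<bar>F (x + h *\<^sub>R v) - F x - q * h\<bar> \<le> \<epsilon> * h}"

lemma closed_right_slope_set:
  assumes "continuous_on UNIV F"
  shows "closed (right_slope_set F v q \<epsilon> r)"
proof -
  have "right_slope_set F v q \<epsilon> r =
      (\<Inter>h\<in>{0<..<r}. {x. \<bar>F (x + h *\<^sub>R v) - F x - q * h\<bar> \<le> \<epsilon> * h})"
    by (auto simp: right_slope_set_def)
  also have "closed \<dots>"
    by (intro closed_INT ballI closed_Collect_le continuous_intros continuous_on_compose2[OF assms]
        continuous_on_subset[OF assms]) auto
  finally show ?thesis .
qed

lemma lipschitz_on_line:
  fixes F :: "'n::real_normed_vector \<Rightarrow> real"
  assumes "L-lipschitz_on UNIV F"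
  shows "(L * norm v)-lipschitz_on UNIV (\<lambda>t. F (x + t *\<^sub>R v))"
proof (rule lipschitz_onI)
  fix s t :: real
  have "dist (F (x + s *\<^sub>R v)) (F (x + t *\<^sub>R v)) \<le> L * dist (x + s *\<^sub>R v) (x + t *\<^sub>R v)"
    using lipschitz_onD[OF assms] by blast
  also have "dist (x + s *\<^sub>R v) (x + t *\<^sub>R v) = norm v * dist s t"
    by (simp add: dist_norm flip: scaleR_left_diff_distrib)
  finally show "dist (F (x + s *\<^sub>R v)) (F (x + t *\<^sub>R v)) \<le> L * norm v * dist s t" by simp
qed (use lipschitz_on_nonneg[OF assms] in simp)

lemma negligible_of_negligible_on_lines:
  fixes N :: "'n::euclidean_space set"
  assumes N: "N \<in> sets borel" and null: "\<And>x. negligible {t. x + t *\<^sub>R v \<in> N}"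
  shows "negligible N"
proof -
  have "{t. x + t *\<^sub>R v \<in> N} \<in> null_sets lborel" for x
  proof -
    have "(\<lambda>t. x + t *\<^sub>R v) -` N \<inter> space borel \<in> sets borel"
      by (rule measurable_sets[OF borel_measurable_continuous_onI N]) (intro continuous_intros)
    then have "{t. x + t *\<^sub>R v \<in> N} \<in> sets lborel" by (simp add: vimage_def)
    then show ?thesis
      using null[of x] by (simp add: negligible_iff_null_sets null_sets_completion_iff)
  qed
  then have "N \<in> null_sets lborel" by (rule null_set_of_null_on_lines[OF N])
  then show ?thesis by (simp add: negligible_iff_null_sets null_sets_completionI)
qed

text \<open>On each line parallel to \<open>v\<close> the function is Lipschitz in one variable.
  Rational slopes and reciprocal integers as scales make the exceptional set Borel, as the argument
  over lines requires.\<close>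

lemma negligible_not_right_slope:
  fixes F :: "'n::euclidean_space \<Rightarrow> real"
  assumes lip: "L-lipschitz_on UNIV F"
  shows "negligible (- (\<Inter>j::nat. \<Union>q\<in>\<rat>. \<Union>n::nat. right_slope_set F v q (1 / Suc j) (1 / Suc n)))"
    (is "negligible (- ?G)")
proof (rule negligible_of_negligible_on_lines)
  have cF: "continuous_on UNIV F" using lip lipschitz_on_continuous_on by blast
  show "- ?G \<in> sets borel"
    by (intro borel_comp sets.countable_INT'' sets.countable_UN'' countable_rat borel_closed
        closed_right_slope_set cF) auto
  fix x
  let ?f = "\<lambda>t. F (x + t *\<^sub>R v)"
  have "x + t *\<^sub>R v \<in> ?G"
    if d: "\<forall>e>0. eventually (\<lambda>s. \<bar>?f s - ?f t - d * (s - t)\<bar> \<le> e * (s - t)) (at_right t)" for t d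
  proof (rule INT_I)
    fix j :: nat
    \<comment> \<open>Half of the tolerance \<open>1 / Suc j\<close> goes into differentiability,
      half into replacing \<open>d\<close> by a rational \<open>q\<close>.\<close>
    define e where "e = 1 / (2 * real (Suc j))"
    have e: "0 < e" "1 / real (Suc j) = 2 * e" by (auto simp: e_def field_simps)
    obtain q where q: "q \<in> \<rat>" "d < q" "q < d + e" using Rats_dense_in_real[of d "d + e"] e by auto
    have "eventually (\<lambda>s. \<bar>?f s - ?f t - d * (s - t)\<bar> \<le> e * (s - t)) (at_right t)"
      using d e(1) by blast
    then obtain b where b: "t < b" "\<And>s. t < s \<Longrightarrow> s < b \<Longrightarrow> \<bar>?f s - ?f t - d * (s - t)\<bar> \<le> e * (s - t)"
      unfolding eventually_at_right_field by blast
    obtain n :: nat where n: "1 / Suc n < b - t" using b(1) nat_approx_posE[of "b - t"] by auto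
    have "x + t *\<^sub>R v \<in> right_slope_set F v q (1 / Suc j) (1 / Suc n)"
      unfolding right_slope_set_def
    proof (intro CollectI ballI)
      fix h assume "h \<in> {0<..<1 / real (Suc n)}"
      then have h: "0 < h" "h < b - t" using n by auto
      have "\<bar>?f (t + h) - ?f t - d * h\<bar> \<le> e * h" using b(2)[of "t + h"] h by simp
      moreover have "d * h \<le> q * h" "q * h \<le> (d + e) * h"
        using q h by (auto intro!: mult_right_mono)
      then have "\<bar>d * h - q * h\<bar> \<le> e * h" by (simp add: algebra_simps)
      ultimately have "\<bar>?f (t + h) - ?f t - q * h\<bar> \<le> 2 * e * h" by linarith
      then show "\<bar>F (x + t *\<^sub>R v + h *\<^sub>R v) - ?f t - q * h\<bar> \<le> 1 / real (Suc j) * h"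
        unfolding e(2) by (simp add: algebra_simps)
    qed
    then show "x + t *\<^sub>R v \<in> (\<Union>q\<in>\<rat>. \<Union>n::nat. right_slope_set F v q (1 / Suc j) (1 / Suc n))"
      using q(1) by blast
  qed
  then have G: "x + t *\<^sub>R v \<in> ?G"
    if "\<exists>d. \<forall>e>0. eventually (\<lambda>s. \<bar>?f s - ?f t - d * (s - t)\<bar> \<le> e * (s - t)) (at_right t)" for t
    using that by (elim exE)
  have "{t. x + t *\<^sub>R v \<in> - ?G} \<subseteq>
      {t. \<not> (\<exists>d. \<forall>e>0. eventually (\<lambda>s. \<bar>?f s - ?f t - d * (s - t)\<bar> \<le> e * (s - t)) (at_right t))}"
    by (intro Collect_mono impI notI) (simp only: Compl_iff, erule notE, erule G)
  then show "negligible {t. x + t *\<^sub>R v \<in> - ?G}"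
    using lipschitz_real_right_derivative[OF lipschitz_on_line[OF lip]] negligible_subset by blast
qed

text \<open>Nonporosity of the slope sets upgrades the right slope at \<open>x\<close> to a two-sided slope
  along all segments parallel to \<open>v\<close> near \<open>x\<close>.\<close>

lemma strong_slope_of_right_slope:
  fixes F :: "'n::euclidean_space \<Rightarrow> real"
  assumes lip: "L-lipschitz_on UNIV F" and v: "norm v = 1"
    and x: "x \<in> (\<Inter>j::nat. \<Union>q\<in>\<rat>. \<Union>n::nat. right_slope_set F v q (1 / Suc j) (1 / Suc n))"
    and dens: "\<And>q j n. q \<in> \<rat> \<Longrightarrow> x \<in> right_slope_set F v q (1 / Suc j) (1 / Suc n) \<Longrightarrow>
      density_point x (right_slope_set F v q (1 / real (Suc j)) (1 / real (Suc n)))"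
  shows "\<exists>d. \<forall>\<epsilon>>0. \<exists>\<delta>>0. \<forall>p t. dist p x < \<delta> \<longrightarrow> \<bar>t\<bar> < \<delta> \<longrightarrow>
    \<bar>F (p + t *\<^sub>R v) - F p - d * t\<bar> \<le> \<epsilon> * (dist p x + \<bar>t\<bar>)"
proof -
  have L: "0 \<le> L" using lip lipschitz_on_nonneg by blast
  have cF: "continuous_on UNIV F" using lip lipschitz_on_continuous_on by blast
  have "\<forall>j. \<exists>q n. q \<in> \<rat> \<and> x \<in> right_slope_set F v q (1 / Suc j) (1 / real (Suc n))"
    using x by blast
  then obtain q n where qn: "\<And>j. q j \<in> \<rat>"
    "\<And>j. x \<in> right_slope_set F v (q j) (1 / Suc j) (1 / real (Suc (n j)))"
    by metis
  \<comment> \<open>Both slopes approximate the same difference quotient at \<open>x\<close> for a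
    common small \<open>h\<close>; so they form a Cauchy sequence, whose limit is the slope
    sought.\<close>
  have qdiff: "\<bar>q i - q j\<bar> \<le> 1 / Suc i + 1 / Suc j" for i j
  proof -
    obtain h where h: "0 < h" "h < 1 / real (Suc (n i))" "h < 1 / real (Suc (n j))"
      using field_lbound_gt_zero[of "1 / real (Suc (n i))" "1 / real (Suc (n j))"] by auto
    have "\<bar>F (x + h *\<^sub>R v) - F x - q i * h\<bar> \<le> 1 / Suc i * h"
      "\<bar>F (x + h *\<^sub>R v) - F x - q j * h\<bar> \<le> 1 / Suc j * h"
      using qn(2)[of i] qn(2)[of j] h unfolding right_slope_set_def by auto
    then have "\<bar>q i * h - q j * h\<bar> \<le> 1 / Suc i * h + 1 / Suc j * h" by linarith
    then have "\<bar>q i - q j\<bar> * h \<le> (1 / Suc i + 1 / Suc j) * h"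
      using h by (simp add: distrib_right abs_mult flip: left_diff_distrib)
    then show ?thesis using h by simp
  qed
  have "Cauchy q"
  proof (rule metric_CauchyI)
    fix e :: real assume "0 < e"
    then obtain k :: nat where k: "1 / Suc k < e / 2" using nat_approx_posE[of "e / 2"] by auto
    have "dist (q i) (q j) < e" if "k \<le> i" "k \<le> j" for i j
    proof -
      have "1 / real (Suc i) \<le> 1 / Suc k" "1 / real (Suc j) \<le> 1 / Suc k"
        using that by (auto intro!: divide_left_mono)
      then show ?thesis using qdiff[of i j] k by (simp add: dist_real_def)
    qed
    then show "\<exists>M. \<forall>m\<ge>M. \<forall>n\<ge>M. dist (q m) (q n) < e" by blast
  qed
  then obtain d where d: "q \<longlonglongrightarrow> d" using Cauchy_convergent convergent_def by blast
  have qd: "\<bar>q j - d\<bar> \<le> 1 / Suc j" for j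
  proof -
    have "(\<lambda>i. \<bar>q j - q i\<bar>) \<longlonglongrightarrow> \<bar>q j - d\<bar>" by (intro tendsto_intros d)
    moreover have "(\<lambda>i. 1 / Suc j + 1 / Suc i) \<longlonglongrightarrow> 1 / Suc j + 0"
      using LIMSEQ_inverse_real_of_nat by (intro tendsto_intros) (simp add: inverse_eq_divide)
    ultimately have "\<bar>q j - d\<bar> \<le> 1 / Suc j + 0"
      by (rule LIMSEQ_le) (use qdiff in blast)
    then show ?thesis by simp
  qed
  show ?thesis
  proof (rule exI[of _ d], intro allI impI)
    fix \<epsilon> :: real assume "0 < \<epsilon>"
    then obtain j :: nat where j: "1 / Suc j < \<epsilon> / 4" using nat_approx_posE[of "\<epsilon> / 4"] by auto
    \<comment> \<open>Three errors of at most \<open>J * R\<close> will arise: moving to a point of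
      \<open>?A\<close>, the slope error there, and replacing \<open>q j\<close> by
      \<open>d\<close>.\<close>
    define J where "J = 1 / real (Suc j)"
    have J: "0 < J" "J < \<epsilon> / 4" using j by (auto simp: J_def)
    let ?A = "right_slope_set F v (q j) J (1 / real (Suc (n j)))"
    have xA: "x \<in> ?A" using qn(2)[of j] by (simp add: J_def)
    have "density_point x ?A" using dens[OF qn(1) qn(2)] by (simp add: J_def)
    moreover have "?A \<in> sets lebesgue" using closed_right_slope_set[OF cF] by (simp add: borel_closed)
    \<comment> \<open>Moving both ends of a segment by this share of \<open>R\<close> changes
      \<open>F\<close> by at most \<open>J * R\<close> in total.\<close>
    moreover have "0 < J / (2 * L + 1)" using J L by (simp add: add_nonneg_pos)
    ultimately obtain \<delta> where \<delta>: "0 < \<delta>"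
      "\<And>p. p \<noteq> x \<Longrightarrow> dist p x < \<delta> \<Longrightarrow> \<exists>y\<in>?A. dist y p \<le> J / (2 * L + 1) * dist p x"
      by (rule density_point_nonporous) blast
    define \<delta>' where "\<delta>' = min (\<delta> / 2) (1 / real (Suc (n j)))"
    show "\<exists>\<delta>>0. \<forall>p t. dist p x < \<delta> \<longrightarrow> \<bar>t\<bar> < \<delta> \<longrightarrow>
        \<bar>F (p + t *\<^sub>R v) - F p - d * t\<bar> \<le> \<epsilon> * (dist p x + \<bar>t\<bar>)"
    proof (intro exI[of _ \<delta>'] conjI allI impI)
      show "0 < \<delta>'" using \<delta> by (simp add: \<delta>'_def)
      fix p t assume pt: "dist p x < \<delta>'" "\<bar>t\<bar> < \<delta>'"
      define R where "R = dist p x + \<bar>t\<bar>"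
      \<comment> \<open>Slope sets look in the direction of \<open>v\<close> only, so for negative
        \<open>t\<close> the segment is read from its other end.\<close>
      define b where "b = (if 0 \<le> t then p else p + t *\<^sub>R v)"
      have "dist b x \<le> R"
        using norm_triangle_ineq[of "p - x" "t *\<^sub>R v"] v
        by (auto simp: b_def R_def dist_norm algebra_simps)
      have "0 \<le> R" by (simp add: R_def)
      have "R < \<delta>" using pt by (simp add: R_def \<delta>'_def)
      obtain y where y: "y \<in> ?A" "dist y b \<le> J / (2 * L + 1) * R"
      proof (cases "b = x")
        case True
        then show thesis using that[of x] xA J L \<open>0 \<le> R\<close> by simp
      next
        case False
        then obtain y where "y \<in> ?A" "dist y b \<le> J / (2 * L + 1) * dist b x"
          using \<delta>(2)[of b] \<open>dist b x \<le> R\<close> \<open>R < \<delta>\<close> by auto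
        moreover have "J / (2 * L + 1) * dist b x \<le> J / (2 * L + 1) * R"
          using \<open>dist b x \<le> R\<close> J L by (intro mult_left_mono) auto
        ultimately show thesis using that[of y] by linarith
      qed
      define s where "s = \<bar>t\<bar>"
      have yslope: "\<bar>F (y + s *\<^sub>R v) - F y - q j * s\<bar> \<le> J * s"
      proof (cases "s = 0")
        case False
        then have "s \<in> {0<..<1 / real (Suc (n j))}" using pt by (auto simp: s_def \<delta>'_def)
        then show ?thesis using y(1) unfolding right_slope_set_def by blast
      qed simp
      have "L * dist y b \<le> L * (J / (2 * L + 1) * R)" using y(2) L by (rule mult_left_mono)
      also have "2 * (L * (J / (2 * L + 1) * R)) = (2 * L / (2 * L + 1)) * (J * R)" by simp
      also have "\<dots> \<le> 1 * (J * R)"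
        using L J \<open>0 \<le> R\<close> by (intro mult_right_mono) (auto simp: divide_le_eq)
      finally have Lyb: "2 * (L * dist y b) \<le> J * R" by simp
      have "\<bar>F y - F b\<bar> \<le> L * dist y b" "\<bar>F (y + s *\<^sub>R v) - F (b + s *\<^sub>R v)\<bar> \<le> L * dist y b"
        using lipschitz_onD[OF lip, of y b] lipschitz_onD[OF lip, of "y + s *\<^sub>R v" "b + s *\<^sub>R v"]
        by (auto simp: dist_real_def)
      with yslope Lyb have "\<bar>F (b + s *\<^sub>R v) - F b - q j * s\<bar> \<le> J * R + J * s" by linarith
      moreover have "s \<le> R" by (simp add: s_def R_def)
      then have "J * s \<le> J * R" using J by simp
      ultimately have bq: "\<bar>F (b + s *\<^sub>R v) - F b - q j * s\<bar> \<le> 2 * (J * R)" by linarith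
      have pq: "\<bar>F (p + t *\<^sub>R v) - F p - q j * t\<bar> \<le> 2 * (J * R)"
      proof (cases "0 \<le> t")
        case True
        then show ?thesis using bq by (simp add: b_def s_def)
      next
        case False
        then have "F (b + s *\<^sub>R v) = F p" "F b = F (p + t *\<^sub>R v)" "q j * s = - (q j * t)"
          by (auto simp: b_def s_def)
        then show ?thesis using bq by linarith
      qed
      have "\<bar>q j * t - d * t\<bar> \<le> J * R"
      proof -
        have "\<bar>q j * t - d * t\<bar> = \<bar>q j - d\<bar> * s" by (simp add: s_def abs_mult flip: left_diff_distrib)
        also have "\<dots> \<le> J * R" using qd[of j] \<open>s \<le> R\<close> J
          by (intro mult_mono) (auto simp: J_def s_def)
        finally show ?thesis .
      qed
      with pq have "\<bar>F (p + t *\<^sub>R v) - F p - d * t\<bar> \<le> 3 * J * R" by linarith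
      also have "\<dots> \<le> \<epsilon> * R" using J \<open>0 \<le> R\<close> by (intro mult_right_mono) auto
      finally show "\<bar>F (p + t *\<^sub>R v) - F p - d * t\<bar> \<le> \<epsilon> * (dist p x + \<bar>t\<bar>)" by (simp add: R_def)
    qed
  qed
qed

text \<open>The increment \<open>h\<close> is added one coordinate at a time, so the slope along a
  basis vector is used at displaced points \<open>p\<close>. This is why the hypothesis concerns all
  segments near \<open>x\<close>, with an error measured by
  \<open>dist p x + \<bar>t\<bar>\<close>.\<close>

lemma has_derivative_of_strong_slopes:
  fixes F :: "'n::euclidean_space \<Rightarrow> real"
  assumes slope: "\<And>e \<epsilon>. e \<in> Basis \<Longrightarrow> 0 < \<epsilon> \<Longrightarrow> \<exists>\<delta>>0. \<forall>p t. dist p x < \<delta> \<longrightarrow> \<bar>t\<bar> < \<delta> \<longrightarrow>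
    \<bar>F (p + t *\<^sub>R e) - F p - d e * t\<bar> \<le> \<epsilon> * (dist p x + \<bar>t\<bar>)"
  shows "(F has_derivative (\<lambda>h. \<Sum>e\<in>Basis. d e * (h \<bullet> e))) (at x)"
proof -
  have step: "\<forall>\<epsilon>>0. \<exists>\<delta>>0. \<forall>h::'n. norm h < \<delta> \<longrightarrow>
      \<bar>F (x + (\<Sum>e\<in>B. (h \<bullet> e) *\<^sub>R e)) - F x - (\<Sum>e\<in>B. d e * (h \<bullet> e))\<bar> \<le> \<epsilon> * norm h"
    if "finite B" "B \<subseteq> Basis" for B
    using that
  proof (induction B rule: finite_induct)
    case empty
    show ?case by (auto intro: exI[of _ 1])
  next
    case (insert b B)
    show ?case
    proof (intro allI impI)
      fix \<epsilon> :: real assume "0 < \<epsilon>"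
      \<comment> \<open>The partial sum over \<open>B\<close> displaces \<open>x\<close> by at most
        \<open>card B * norm h\<close>, and the new step adds at most \<open>norm h\<close>;
        dividing the tolerance by \<open>c\<close> compensates.\<close>
      define c where "c = real (card B) + 1"
      have c: "0 < c" by (simp add: c_def)
      have "0 < \<epsilon> / 2" "B \<subseteq> Basis" using \<open>0 < \<epsilon>\<close> insert.prems by auto
      with insert.IH obtain \<delta>1 where \<delta>1: "0 < \<delta>1" "\<And>h::'n. norm h < \<delta>1 \<Longrightarrow>
        \<bar>F (x + (\<Sum>e\<in>B. (h \<bullet> e) *\<^sub>R e)) - F x - (\<Sum>e\<in>B. d e * (h \<bullet> e))\<bar> \<le> \<epsilon> / 2 * norm h"
        by blast
      have "b \<in> Basis" "0 < \<epsilon> / (2 * c)" using insert.prems \<open>0 < \<epsilon>\<close> c by auto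
      from slope[OF this] obtain \<delta>2 where \<delta>2: "0 < \<delta>2" "\<And>p t. dist p x < \<delta>2 \<Longrightarrow> \<bar>t\<bar> < \<delta>2 \<Longrightarrow>
        \<bar>F (p + t *\<^sub>R b) - F p - d b * t\<bar> \<le> \<epsilon> / (2 * c) * (dist p x + \<bar>t\<bar>)" by blast
      show "\<exists>\<delta>>0. \<forall>h::'n. norm h < \<delta> \<longrightarrow> \<bar>F (x + (\<Sum>e\<in>insert b B. (h \<bullet> e) *\<^sub>R e)) - F x -
          (\<Sum>e\<in>insert b B. d e * (h \<bullet> e))\<bar> \<le> \<epsilon> * norm h"
      proof (intro exI[of _ "min \<delta>1 (\<delta>2 / c)"] conjI allI impI)
        show "0 < min \<delta>1 (\<delta>2 / c)" using \<delta>1 \<delta>2 c by simp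
        fix h :: 'n assume h: "norm h < min \<delta>1 (\<delta>2 / c)"
        define p where "p = x + (\<Sum>e\<in>B. (h \<bullet> e) *\<^sub>R e)"
        have "dist p x \<le> (\<Sum>e\<in>B. norm ((h \<bullet> e) *\<^sub>R e))"
          by (simp add: p_def dist_norm norm_sum del: norm_scaleR)
        also have "\<dots> \<le> (\<Sum>e\<in>B. norm h)"
          using \<open>B \<subseteq> Basis\<close> by (intro sum_mono) (auto simp: Basis_le_norm)
        finally have "dist p x \<le> real (card B) * norm h" by simp
        moreover have hb: "\<bar>h \<bullet> b\<bar> \<le> norm h" using \<open>b \<in> Basis\<close> by (rule Basis_le_norm)
        ultimately have R: "dist p x + \<bar>h \<bullet> b\<bar> \<le> c * norm h" by (simp add: c_def algebra_simps)
        have "c * norm h < \<delta>2" using h c by (simp add: pos_less_divide_eq mult.commute)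
        then have "dist p x < \<delta>2" "\<bar>h \<bullet> b\<bar> < \<delta>2" using R zero_le_dist[of p x] by linarith+
        from \<delta>2(2)[OF this]
        have "\<bar>F (p + (h \<bullet> b) *\<^sub>R b) - F p - d b * (h \<bullet> b)\<bar> \<le> \<epsilon> / (2 * c) * (dist p x + \<bar>h \<bullet> b\<bar>)" .
        also have "\<dots> \<le> \<epsilon> / (2 * c) * (c * norm h)"
          using R \<open>0 < \<epsilon> / (2 * c)\<close> by (intro mult_left_mono) auto
        also have "\<dots> = \<epsilon> / 2 * norm h" using c by simp
        finally have 1: "\<bar>F (p + (h \<bullet> b) *\<^sub>R b) - F p - d b * (h \<bullet> b)\<bar> \<le> \<epsilon> / 2 * norm h" .
        have 2: "\<bar>F p - F x - (\<Sum>e\<in>B. d e * (h \<bullet> e))\<bar> \<le> \<epsilon> / 2 * norm h"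
          using \<delta>1(2)[of h] h by (simp add: p_def)
        have eq1: "x + (\<Sum>e\<in>insert b B. (h \<bullet> e) *\<^sub>R e) = p + (h \<bullet> b) *\<^sub>R b"
          using insert.hyps by (simp add: p_def algebra_simps)
        have eq2: "(\<Sum>e\<in>insert b B. d e * (h \<bullet> e)) = d b * (h \<bullet> b) + (\<Sum>e\<in>B. d e * (h \<bullet> e))"
          using insert.hyps by simp
        have "\<epsilon> * norm h = \<epsilon> / 2 * norm h + \<epsilon> / 2 * norm h" by simp
        then show "\<bar>F (x + (\<Sum>e\<in>insert b B. (h \<bullet> e) *\<^sub>R e)) - F x -
          (\<Sum>e\<in>insert b B. d e * (h \<bullet> e))\<bar> \<le> \<epsilon> * norm h"
          using 1 2 unfolding eq1 eq2 by linarith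
      qed
    qed
  qed
  show ?thesis
    unfolding has_derivative_at_alt
  proof (intro conjI allI impI)
    show "bounded_linear (\<lambda>h. \<Sum>e\<in>Basis. d e * (h \<bullet> e))"
      by (intro bounded_linear_sum bounded_linear_const_mult bounded_linear_inner_left)
    fix \<epsilon> :: real assume "0 < \<epsilon>"
    then obtain \<delta> where \<delta>: "0 < \<delta>" "\<And>h::'n. norm h < \<delta> \<Longrightarrow>
      \<bar>F (x + (\<Sum>e\<in>Basis. (h \<bullet> e) *\<^sub>R e)) - F x - (\<Sum>e\<in>Basis. d e * (h \<bullet> e))\<bar> \<le> \<epsilon> * norm h"
      using step[of Basis] by auto
    show "\<exists>\<delta>>0. \<forall>y. norm (y - x) < \<delta> \<longrightarrow>
        norm (F y - F x - (\<Sum>e\<in>Basis. d e * ((y - x) \<bullet> e))) \<le> \<epsilon> * norm (y - x)"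
    proof (intro exI[of _ \<delta>] conjI allI impI \<delta>(1))
      fix y assume "norm (y - x) < \<delta>"
      from \<delta>(2)[OF this] show "norm (F y - F x - (\<Sum>e\<in>Basis. d e * ((y - x) \<bullet> e))) \<le> \<epsilon> * norm (y - x)"
        by (simp add: euclidean_representation)
    qed
  qed
qed

text \<open>Slopes in the basis directions add up to the total derivative once they hold on all
  segments near \<open>x\<close>, which needs \<open>x\<close> to be a density point of its slope
  sets; these are countable in number because the slopes \<open>q\<close> are rational.\<close>

theorem rademacher:
  fixes F :: "'n::euclidean_space \<Rightarrow> real"
  assumes lip: "L-lipschitz_on UNIV F"
  shows "negligible {x. \<not> F differentiable (at x)}"
proof -
  have cF: "continuous_on UNIV F" using lip lipschitz_on_continuous_on by blast
  define A where "A v q j n = right_slope_set F v q (1 / real (Suc j)) (1 / real (Suc n))"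
    for v q j n
  define G where "G v = (\<Inter>j. \<Union>q\<in>\<rat>. \<Union>n. A v q j n)" for v
  have A: "A v q j n \<in> sets lebesgue" for v q j n
    using closed_right_slope_set[OF cF] by (simp add: A_def borel_closed)
  have "negligible (- G v)" for v
    using negligible_not_right_slope[OF lip] by (simp add: G_def A_def)
  then have 1: "negligible (\<Union>v\<in>Basis. - G v)" by (intro negligible_Union) auto
  have "negligible {x \<in> A v q j n. \<not> density_point x (A v q j n)}" for v q j n
    by (rule negligible_non_density_points[OF A])
  then have "negligible (\<Union>(v, q, j, n)\<in>Basis \<times> \<rat> \<times> UNIV \<times> UNIV.
      {x \<in> A v q j n. \<not> density_point x (A v q j n)})"
    by (intro negligible_countable_Union countable_image countable_SIGMA)
      (auto simp: countable_rat countable_finite)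
  with 1 have "negligible ((\<Union>v\<in>Basis. - G v) \<union> (\<Union>(v, q, j, n)\<in>Basis \<times> \<rat> \<times> UNIV \<times> UNIV.
      {x \<in> A v q j n. \<not> density_point x (A v q j n)}))" (is "negligible ?N")
    by (rule negligible_Un)
  moreover have "F differentiable (at x)" if x: "x \<notin> ?N" for x
  proof -
    have "\<exists>d. \<forall>\<epsilon>>0. \<exists>\<delta>>0. \<forall>p t. dist p x < \<delta> \<longrightarrow> \<bar>t\<bar> < \<delta> \<longrightarrow>
      \<bar>F (p + t *\<^sub>R e) - F p - d * t\<bar> \<le> \<epsilon> * (dist p x + \<bar>t\<bar>)" if e: "e \<in> Basis" for e
    proof (rule strong_slope_of_right_slope[OF lip])
      show "norm e = 1" using e by simp
      show "x \<in> (\<Inter>j::nat. \<Union>q\<in>\<rat>. \<Union>n::nat. right_slope_set F e q (1 / Suc j) (1 / Suc n))"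
        using x e by (auto simp: G_def A_def)
      show "density_point x (right_slope_set F e q (1 / real (Suc j)) (1 / real (Suc n)))"
        if "q \<in> \<rat>" "x \<in> right_slope_set F e q (1 / Suc j) (1 / Suc n)" for q j n
        using x e that unfolding A_def by blast
    qed
    then obtain d where "\<And>e \<epsilon>. e \<in> Basis \<Longrightarrow> 0 < \<epsilon> \<Longrightarrow> \<exists>\<delta>>0. \<forall>p t. dist p x < \<delta> \<longrightarrow> \<bar>t\<bar> < \<delta> \<longrightarrow>
      \<bar>F (p + t *\<^sub>R e) - F p - d e * t\<bar> \<le> \<epsilon> * (dist p x + \<bar>t\<bar>)"
      by metis
    then show ?thesis
      using has_derivative_of_strong_slopes unfolding differentiable_def by blast
  qed
  then have "{x. \<not> F differentiable (at x)} \<subseteq> ?N" by blast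
  ultimately show ?thesis by (rule negligible_subset)
qed

text \<open>On a line parallel to \<open>v\<close>, the increments of all \<open>F i\<close> are controlled simultaneously by the
  measure of the complement of the first set, which is small near its density points.\<close>

lemma negligible_nonuniform_slopes:
  fixes F :: "'i::countable \<Rightarrow> 'n::euclidean_space \<Rightarrow> real"
  assumes lip: "\<And>i. L-lipschitz_on UNIV (F i)" and "0 < \<eta>"
  shows "negligible ((\<Inter>i. \<Union>n::nat. right_slope_set (F i) v 0 \<eta> (1 / Suc n))
      - (\<Union>n::nat. \<Inter>i. right_slope_set (F i) v 0 (2 * \<eta>) (1 / Suc n)))"
    (is "negligible (?S - ?T)")
proof (rule negligible_of_negligible_on_lines)
  have cF: "continuous_on UNIV (F i)" for i using lip lipschitz_on_continuous_on by blast
  have S: "?S \<in> sets borel"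
    by (intro sets.countable_INT'' sets.countable_UN'' borel_closed closed_right_slope_set cF) auto
  have "?T \<in> sets borel"
    by (intro sets.countable_INT'' sets.countable_UN'' borel_closed closed_right_slope_set cF) auto
  with S show "?S - ?T \<in> sets borel" by blast
  fix x
  define A where "A = {t. x + t *\<^sub>R v \<in> ?S}"
  have "(\<lambda>t. x + t *\<^sub>R v) -` ?S \<inter> space borel \<in> sets borel"
    by (rule measurable_sets[OF borel_measurable_continuous_onI S]) (intro continuous_intros)
  then have A: "A \<in> sets lebesgue" by (simp add: vimage_def A_def)
  define K where "K = L * norm v"
  have lipK: "K-lipschitz_on UNIV (\<lambda>t. F i (x + t *\<^sub>R v))" for i
    unfolding K_def by (rule lipschitz_on_line[OF lip])
  then have K: "0 \<le> K" using lipschitz_on_nonneg by blast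
  have slope: "\<exists>b>s. \<forall>r. s < r \<longrightarrow> r < b \<longrightarrow> \<bar>F i (x + r *\<^sub>R v) - F i (x + s *\<^sub>R v)\<bar> \<le> \<eta> * (r - s)"
    if s: "s \<in> A" for s i
  proof -
    obtain n :: nat where n: "x + s *\<^sub>R v \<in> right_slope_set (F i) v 0 \<eta> (1 / Suc n)"
      using s unfolding A_def by blast
    show ?thesis
    proof (intro exI[of _ "s + 1 / Suc n"] conjI allI impI)
      fix r assume "s < r" "r < s + 1 / Suc n"
      then have "r - s \<in> {0<..<1 / real (Suc n)}" by auto
      with n have "\<bar>F i (x + s *\<^sub>R v + (r - s) *\<^sub>R v) - F i (x + s *\<^sub>R v) - 0 * (r - s)\<bar> \<le> \<eta> * (r - s)"
        unfolding right_slope_set_def by blast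
      then show "\<bar>F i (x + r *\<^sub>R v) - F i (x + s *\<^sub>R v)\<bar> \<le> \<eta> * (r - s)"
        by (simp add: algebra_simps)
    qed simp
  qed
  have "x + t *\<^sub>R v \<in> ?T" if t: "t \<in> A" "density_point t A" for t
  proof -
    \<comment> \<open>Besides the slope \<eta> on \<open>A\<close>, the complement of
      \<open>A\<close> adds at most \<open>K * e * h \<le> \<eta> * h\<close>; this is the passage
      from \<eta> to \<open>2 * \<eta>\<close>.\<close>
    define e where "e = \<eta> / (K + 1)"
    have e: "0 < e" "K * e \<le> \<eta>"
      using \<open>0 < \<eta>\<close> K by (auto simp: e_def divide_simps algebra_simps)
    obtain \<delta> where \<delta>: "0 < \<delta>" "\<And>s. 0 < s \<Longrightarrow> s < \<delta> \<Longrightarrow> measure lebesgue ({t-s..t+s} - A) \<le> e * s"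
      using density_point_real_interval[OF t(2) A e(1)] by metis
    \<comment> \<open>\<open>\<delta>\<close> was obtained from \<open>A\<close> alone, hence this
      \<open>n\<close> serves all \<open>i\<close> at once.\<close>
    obtain n :: nat where n: "1 / Suc n < \<delta>" using \<delta>(1) nat_approx_posE[of \<delta>] by auto
    have "x + t *\<^sub>R v \<in> right_slope_set (F i) v 0 (2 * \<eta>) (1 / Suc n)" for i
      unfolding right_slope_set_def
    proof (intro CollectI ballI)
      fix h assume "h \<in> {0<..<1 / real (Suc n)}"
      then have h: "0 < h" "h < \<delta>" using n by auto
      define f where "f s = F i (x + s *\<^sub>R v)" for s
      have fl: "K-lipschitz_on {t..t+h} f" "K-lipschitz_on {t..t+h} (\<lambda>s. - f s)"
        unfolding f_def lipschitz_on_minus_iff by (rule lipschitz_on_subset[OF lipK subset_UNIV])+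
      have "measure lebesgue ({t..t+h} - A) \<le> measure lebesgue ({t-h..t+h} - A)"
        using h A by (intro measure_mono_fmeasurable) (auto intro: fmeasurable_Diff)
      also have "\<dots> \<le> e * h" using \<delta>(2)[OF h] .
      finally have "K * measure lebesgue ({t..t+h} - A) \<le> K * e * h"
        using K by (simp add: mult_left_mono mult.assoc)
      also have "\<dots> \<le> \<eta> * h" using e h by (intro mult_right_mono) auto
      finally have m: "K * measure lebesgue ({t..t+h} - A) \<le> \<eta> * h" .
      have ev: "eventually (\<lambda>r. \<bar>f r - f s\<bar> \<le> (\<eta> + e') * (r - s)) (at_right s)" if se: "s \<in> A" "0 < e'" for s e'
      proof -
        obtain b where b: "s < b" "\<And>r. s < r \<Longrightarrow> r < b \<Longrightarrow> \<bar>f r - f s\<bar> \<le> \<eta> * (r - s)"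
          using slope[OF se(1), of i] by (auto simp: f_def)
        have "\<bar>f r - f s\<bar> \<le> (\<eta> + e') * (r - s)" if "s < r" "r < b" for r
          using b(2)[OF that] se(2) that
            mult_right_mono[of \<eta> "\<eta> + e'" "r - s"] by linarith
        then show ?thesis using b(1) unfolding eventually_at_right_field by blast
      qed
      have "f (t + h) - f t \<le> \<eta> * ((t + h) - t) + K * measure lebesgue ({t..t+h} - A)"
        by (rule increment_le_of_right_upper_slope_le[OF fl(1) _ _ A])
          (use h \<open>0 < \<eta>\<close> in \<open>auto intro: eventually_mono[OF ev]\<close>)
      moreover have "- f (t + h) - (- f t) \<le> \<eta> * ((t + h) - t) + K * measure lebesgue ({t..t+h} - A)"
        by (rule increment_le_of_right_upper_slope_le[OF fl(2) _ _ A])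
          (use h \<open>0 < \<eta>\<close> in \<open>auto intro: eventually_mono[OF ev]\<close>)
      ultimately have "\<bar>f (t + h) - f t\<bar> \<le> 2 * \<eta> * h" using m by simp
      then show "\<bar>F i (x + t *\<^sub>R v + h *\<^sub>R v) - F i (x + t *\<^sub>R v) - 0 * h\<bar> \<le> 2 * \<eta> * h"
        by (simp add: f_def algebra_simps)
    qed
    then show ?thesis by blast
  qed
  then have dens: "x + t *\<^sub>R v \<in> ?T" if "t \<in> A" "density_point t A" for t
    using that by blast
  have "{t. x + t *\<^sub>R v \<in> ?S - ?T} \<subseteq> {t \<in> A. \<not> density_point t A}"
  proof
    fix t assume "t \<in> {t. x + t *\<^sub>R v \<in> ?S - ?T}"
    then have "t \<in> A" "x + t *\<^sub>R v \<notin> ?T" unfolding A_def by blast+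
    then show "t \<in> {t \<in> A. \<not> density_point t A}" using dens by blast
  qed
  then show "negligible {t. x + t *\<^sub>R v \<in> ?S - ?T}"
    using negligible_non_density_points[OF A] negligible_subset by blast
qed

section \<open>Approximate and classical derivatives\<close>

text \<open>Existence takes \<open>E\<close> itself as the set of approach. For uniqueness, the
  difference \<open>M\<close> of two candidates is linear, and \<open>M (y - x)\<close> is of
  smaller order than \<open>norm (y - x)\<close> along a set \<open>A\<close> with density point
  \<open>x\<close>. As \<open>A\<close> is not porous at \<open>x\<close>, it has points close to
  every direction, and \<open>M\<close> vanishes.\<close>

lemma has_ap_derivative_iff_eq_derivative:
  fixes F :: "'n::euclidean_space \<Rightarrow> real"
  assumes E: "E \<in> sets lebesgue" "x \<in> E" "density_point x E"
    and F: "(F has_derivative D) (at x)" and eq: "\<And>y. y \<in> E \<Longrightarrow> h y = F y"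
  shows "has_ap_derivative E h x L \<longleftrightarrow> L = D"
proof
  have "bounded_linear D" using F by (rule has_derivative_bounded_linear)
  have lim: "((\<lambda>y. (h y - h x - D (y - x)) / norm (y - x)) \<longlongrightarrow> 0) (at x within A)" if "A \<subseteq> E" for A
  proof -
    have "(F has_derivative D) (at x within A)" using F has_derivative_at_withinI by blast
    then have "((\<lambda>y. (F y - (F x + D (y - x))) / norm (y - x)) \<longlongrightarrow> 0) (at x within A)"
      by (simp add: has_derivative_within divide_inverse mult.commute)
    then show ?thesis
      by (rule Lim_transform_eventually)
        (use that eq E(2) in \<open>auto simp: eventually_at_filter diff_diff_eq subset_iff\<close>)
  qed
  show "has_ap_derivative E h x L" if "L = D"
    using that E lim[OF order_refl] bounded_linear.linear[OF \<open>bounded_linear D\<close>]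
    by (auto simp: has_ap_derivative_def)
  assume L: "has_ap_derivative E h x L"
  then have linL: "linear L" by (simp add: has_ap_derivative_def)
  obtain A where A: "A \<in> sets lebesgue" "A \<subseteq> E" "density_point x A"
    "((\<lambda>y. (h y - h x - L (y - x)) / norm (y - x)) \<longlongrightarrow> 0) (at x within A)"
    using L by (auto simp: has_ap_derivative_def)
  define M where "M u = D u - L u" for u
  have linM: "linear M"
    unfolding M_def by (intro linear_compose_sub bounded_linear.linear \<open>bounded_linear D\<close> linL)
  obtain B where B: "0 < B" "\<And>u. norm (M u) \<le> B * norm u"
    using linear_bounded_pos[OF linM] by blast
  have limM: "((\<lambda>y. M (y - x) / norm (y - x)) \<longlongrightarrow> 0) (at x within A)"
    using tendsto_diff[OF A(4) lim[OF A(2)]] by (simp add: M_def flip: diff_divide_distrib)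
  have "M u = 0" for u
  proof (cases "u = 0")
    case True
    then show ?thesis using linear_0[OF linM] by simp
  next
    case False
    have le: "\<bar>M u\<bar> \<le> \<epsilon> * ((2 + B) * norm u)" if \<epsilon>: "0 < \<epsilon>" "\<epsilon> < 1" for \<epsilon>
    proof -
      obtain \<delta>1 where \<delta>1: "0 < \<delta>1"
        "\<And>y. y \<in> A \<Longrightarrow> y \<noteq> x \<Longrightarrow> dist y x < \<delta>1 \<Longrightarrow> \<bar>M (y - x)\<bar> / norm (y - x) < \<epsilon>"
        using limM \<epsilon>(1) unfolding tendsto_iff eventually_at by (auto simp: dist_real_def)
      obtain \<delta>2 where \<delta>2: "0 < \<delta>2"
        "\<And>p. p \<noteq> x \<Longrightarrow> dist p x < \<delta>2 \<Longrightarrow> \<exists>y\<in>A. dist y p \<le> \<epsilon> * dist p x"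
        using density_point_nonporous[OF A(3,1) \<epsilon>(1)] by metis
      \<comment> \<open>A third of the smaller radius keeps \<open>p\<close> within
        \<open>\<delta>2\<close> of \<open>x\<close>, and the nearby \<open>y\<close>, at distance
        at most \<open>2 * (s * norm u)\<close> from \<open>x\<close>, within
        \<open>\<delta>1\<close>.\<close>
      define s where "s = min \<delta>1 \<delta>2 / (3 * norm u)"
      have s: "0 < s" using \<delta>1 \<delta>2 False by (simp add: s_def)
      have su: "s * norm u = min \<delta>1 \<delta>2 / 3" using False by (simp add: s_def)
      define p where "p = x + s *\<^sub>R u"
      have px: "dist p x = s * norm u" "p \<noteq> x" using s False by (auto simp: p_def dist_norm)
      then have "dist p x < \<delta>2" using su \<delta>1 \<delta>2 by linarith
      then obtain y where y: "y \<in> A" "dist y p \<le> \<epsilon> * dist p x" using \<delta>2(2) px(2) by blast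
      have yx: "dist y x \<le> (1 + \<epsilon>) * (s * norm u)"
        using dist_triangle[of y x p] y(2) px by (simp add: algebra_simps)
      \<comment> \<open>Here \<open>\<epsilon> < 1\<close> keeps \<open>y\<close> different from
        \<open>x\<close>.\<close>
      have "0 < dist p x" using px(2) by simp
      with \<epsilon>(2) have "\<epsilon> * dist p x < 1 * dist p x" by (rule mult_strict_right_mono)
      then have "y \<noteq> x" using y(2) by (auto simp: dist_commute)
      have "(1 + \<epsilon>) * (s * norm u) \<le> 2 * (s * norm u)" using \<epsilon> s by (intro mult_right_mono) auto
      then have yx2: "dist y x \<le> 2 * (s * norm u)" using yx by linarith
      then have "dist y x < \<delta>1" using su \<delta>1 \<delta>2 by linarith
      then have "\<bar>M (y - x)\<bar> / norm (y - x) < \<epsilon>" using \<delta>1(2) y \<open>y \<noteq> x\<close> by blast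
      then have "\<bar>M (y - x)\<bar> \<le> \<epsilon> * norm (y - x)" using \<open>y \<noteq> x\<close> by (simp add: divide_less_eq)
      also have "\<dots> \<le> \<epsilon> * (2 * (s * norm u))"
        using yx2 \<epsilon> by (intro mult_left_mono) (auto simp: dist_norm)
      finally have 1: "\<bar>M (y - x)\<bar> \<le> \<epsilon> * (2 * (s * norm u))" .
      have "\<bar>M (p - y)\<bar> \<le> B * norm (p - y)" using B(2)[of "p - y"] by simp
      also have "\<dots> \<le> B * (\<epsilon> * (s * norm u))"
        using y(2) px(1) B(1) by (intro mult_left_mono) (auto simp: dist_norm norm_minus_commute)
      finally have 2: "\<bar>M (p - y)\<bar> \<le> B * (\<epsilon> * (s * norm u))" .
      have "M (s *\<^sub>R u) = M ((y - x) + (p - y))" by (simp add: p_def)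
      also have "\<dots> = M (y - x) + M (p - y)" by (rule linear_add[OF linM])
      finally have "s * M u = M (y - x) + M (p - y)" using linear_scale[OF linM] by simp
      then have "\<bar>s * M u\<bar> \<le> \<epsilon> * (2 * (s * norm u)) + B * (\<epsilon> * (s * norm u))"
        using 1 2 by linarith
      then have "s * \<bar>M u\<bar> \<le> \<epsilon> * (2 * (s * norm u)) + B * (\<epsilon> * (s * norm u))"
        using s by (simp add: abs_mult)
      also have "\<dots> = s * (\<epsilon> * ((2 + B) * norm u))" by (simp add: algebra_simps)
      finally show ?thesis using s by simp
    qed
    have "\<bar>M u\<bar> \<le> 0"
    proof (rule field_le_epsilon)
      fix e :: real assume "0 < e"
      define \<epsilon> where "\<epsilon> = min (1 / 2) (e / ((2 + B) * norm u))"
      have pos: "0 < (2 + B) * norm u" using B False by simp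
      have "0 < \<epsilon>" "\<epsilon> < 1" using \<open>0 < e\<close> pos by (auto simp: \<epsilon>_def)
      then have "\<bar>M u\<bar> \<le> \<epsilon> * ((2 + B) * norm u)" by (rule le)
      also have "\<dots> \<le> e / ((2 + B) * norm u) * ((2 + B) * norm u)"
        using pos by (intro mult_right_mono) (auto simp: \<epsilon>_def)
      also have "\<dots> = e"
        by (rule nonzero_eq_divide_eq[THEN iffD1, OF _ refl]) (use pos in linarith)
      finally show "\<bar>M u\<bar> \<le> 0 + e" by simp
    qed
    then show ?thesis by simp
  qed
  then show "L = D" by (auto simp: M_def)
qed

section \<open>Lipschitz maps with degenerate derivatives\<close>

text \<open>McShane's extension, the pointwise largest one with constant \<open>L\<close>.\<close>

lemma lipschitz_extend_real:
  fixes f :: "'a::metric_space \<Rightarrow> real"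
  assumes f: "L-lipschitz_on E f"
  shows "\<exists>F. L-lipschitz_on UNIV F \<and> (\<forall>x\<in>E. F x = f x)"
proof (cases "E = {}")
  case True
  then show ?thesis using lipschitz_on_nonneg[OF f] by (intro exI[of _ "\<lambda>_. 0"]) (auto intro: lipschitz_onI)
next
  case False
  have L: "0 \<le> L" using f lipschitz_on_nonneg by blast
  define F where "F x = (INF y\<in>E. f y + L * dist x y)" for x
  have bdd: "bdd_below ((\<lambda>y. f y + L * dist x y) ` E)" for x
  proof -
    obtain z where z: "z \<in> E" using False by blast
    have "f z - L * dist x z \<le> f y + L * dist x y" if "y \<in> E" for y
    proof -
      have "f z - f y \<le> L * dist z y"
        using lipschitz_onD[OF f z that] by (simp add: dist_real_def)
      also have "\<dots> \<le> L * (dist x z + dist x y)"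
        using L dist_triangle3[of z y x] by (intro mult_left_mono) auto
      finally show ?thesis by (simp add: algebra_simps)
    qed
    then show ?thesis by (intro bdd_belowI2)
  qed
  have le: "F x \<le> F y + L * dist x y" for x y
  proof -
    have "F x - L * dist x y \<le> f z + L * dist y z" if "z \<in> E" for z
    proof -
      have "F x \<le> f z + L * dist x z" unfolding F_def by (rule cINF_lower[OF bdd that])
      also have "L * dist x z \<le> L * (dist x y + dist y z)"
        using L dist_triangle[of x z y] by (intro mult_left_mono) auto
      finally show ?thesis by (simp add: algebra_simps)
    qed
    then have "F x - L * dist x y \<le> F y" unfolding F_def[of y] by (rule cINF_greatest[OF False])
    then show ?thesis by simp
  qed
  have "L-lipschitz_on UNIV F"
  proof (rule lipschitz_onI)
    show "dist (F x) (F y) \<le> L * dist x y" for x y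
      using le[of x y] le[of y x] by (simp add: dist_real_def dist_commute)
  qed fact
  moreover have "F x = f x" if x: "x \<in> E" for x
  proof (rule antisym)
    show "F x \<le> f x" using cINF_lower[OF bdd x, of x] by (simp add: F_def)
    show "f x \<le> F x" unfolding F_def
    proof (rule cINF_greatest[OF False])
      fix y assume "y \<in> E"
      then show "f x \<le> f y + L * dist x y"
        using lipschitz_onD[OF f x] by (auto simp: dist_real_def abs_le_iff algebra_simps)
    qed
  qed
  ultimately show ?thesis by blast
qed

section \<open>Rotation and compression of a direction\<close>

lemma emeasure_le_hausdorff_measure:
  fixes S :: "'n::euclidean_space set"
  assumes "S \<in> sets lebesgue"
  shows "emeasure lebesgue S \<le> 2 ^ DIM('n) * hausdorff_measure DIM('n) S"
proof (rule ennreal_le_epsilon)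
  fix e :: real assume e: "0 < e" and fin: "2 ^ DIM('n) * hausdorff_measure DIM('n) S < top"
  then have "hausdorff_measure DIM('n) S \<noteq> top" by (auto simp: ennreal_two_power ennreal_mult_top)
  then have "hausdorff_measure DIM('n) S < hausdorff_measure DIM('n) S + ennreal (e / 2 ^ DIM('n))"
    using e ennreal_add_left_cancel_less[of "hausdorff_measure DIM('n) S" 0] by simp
  then obtain T where T: "T \<in> sets borel" "S \<subseteq> T"
    "emeasure lborel T \<le> 2 ^ DIM('n) * (hausdorff_measure DIM('n) S + ennreal (e / 2 ^ DIM('n)))"
    by (rule hausdorff_measure_less_outer)
  have "emeasure lebesgue S \<le> emeasure lebesgue T" using T by (intro emeasure_mono) auto
  also have "\<dots> \<le> 2 ^ DIM('n) * (hausdorff_measure DIM('n) S + ennreal (e / 2 ^ DIM('n)))"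
    using T by simp
  also have "\<dots> = 2 ^ DIM('n) * hausdorff_measure DIM('n) S + ennreal e"
    using e by (simp add: distrib_left ennreal_two_power ennreal_mult'[symmetric])
  finally show "emeasure lebesgue S \<le> 2 ^ DIM('n) * hausdorff_measure DIM('n) S + ennreal e" .
qed

text \<open>A crude bound for isometries suffices here; the constant \<open>1\<close> would be exact.\<close>

lemma emeasure_orthogonal_image_open_le:
  fixes V :: "'n::euclidean_space set" and T :: "'n \<Rightarrow> 'n"
  assumes T: "orthogonal_transformation T" and V: "open V"
  shows "emeasure lborel (T ` V) \<le> 10 ^ DIM('n) * emeasure lborel V"
proof -
  have "open (T ` V)" using orthogonal_transformation_bij[OF T] T V
    by (intro open_surjective_linear_image orthogonal_transformation_linear) (auto simp: bij_def)
  then have "emeasure lborel (T ` V) = emeasure lebesgue (T ` V)" by simp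
  also have "\<dots> \<le> 2 ^ DIM('n) * hausdorff_measure DIM('n) (T ` V)"
    using \<open>open (T ` V)\<close> by (intro emeasure_le_hausdorff_measure) simp
  also have "hausdorff_measure DIM('n) (T ` V) \<le> ennreal ((5 * 1) ^ DIM('n)) * emeasure lborel V"
    by (rule hausdorff_measure_local_lipschitz_image_le[of _ _ 1])
      (use V T in \<open>auto simp: dist_norm orthogonal_transformation_norm
        simp flip: linear_diff[OF orthogonal_transformation_linear]\<close>)
  finally have "emeasure lborel (T ` V) \<le> 2 ^ DIM('n) * (ennreal ((5 * 1) ^ DIM('n)) * emeasure lborel V)"
    by (simp add: mult_left_mono)
  also have "\<dots> = ennreal (2 ^ DIM('n) * 5 ^ DIM('n)) * emeasure lborel V"
    by (simp add: ennreal_two_power ennreal_mult' mult.assoc)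
  also have "(2::real) ^ DIM('n) * 5 ^ DIM('n) = 10 ^ DIM('n)"
    by (simp flip: power_mult_distrib)
  also have "ennreal (10 ^ DIM('n)) = 10 ^ DIM('n)"
    by (metis ennreal_numeral ennreal_power zero_le_numeral)
  finally show ?thesis .
qed

text \<open>If \<open>f\<close> contracts by \<open>\<eta>\<close> in the direction \<open>v\<close>, then it factors through the linear map that
  compresses the direction \<open>v\<close> by \<open>\<eta>\<close> (after rotating \<open>v\<close> to a coordinate axis), followed by a
  Lipschitz map whose constant does not depend on \<open>\<eta>\<close>.\<close>

lemma hausdorff_measure_image_compressed_direction:
  fixes f :: "real ^ 'k::finite \<Rightarrow> 'a::metric_space"
  assumes P: "P \<in> lmeasurable" and \<eta>: "0 < \<eta>" "\<eta> \<le> 1" and L: "0 \<le> L" and \<rho>: "0 < \<rho>"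
    and v: "norm v = 1" and e: "0 < e"
    and f: "\<And>x y. x \<in> P \<Longrightarrow> y \<in> P \<Longrightarrow> dist x y < \<rho> \<Longrightarrow>
      dist (f x) (f y) \<le> \<eta> * \<bar>(y - x) \<bullet> v\<bar> + L * norm (y - x - ((y - x) \<bullet> v) *\<^sub>R v)"
  shows "hausdorff_measure CARD('k) (f ` P)
    \<le> ennreal ((50 * (1 + L)) ^ CARD('k) * \<eta>) * (emeasure lebesgue P + ennreal e)"
proof -
  fix i :: 'k
  obtain T :: "real ^ 'k \<Rightarrow> real ^ 'k" where T: "orthogonal_transformation T" "T (axis i 1) = v"
    by (rule orthogonal_transformation_exists_1[of "axis i 1" v, OF norm_axis_1 v])
  define T' where "T' = inv T"
  have bij: "bij T" using T(1) by (rule orthogonal_transformation_bij)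
  have T': "orthogonal_transformation T'" unfolding T'_def using T(1) by (rule orthogonal_transformation_inv)
  have TT': "T (T' x) = x" for x unfolding T'_def using bij by (simp add: bij_is_surj surj_f_inv_f)
  have linT': "linear T'" using T' by (rule orthogonal_transformation_linear)
  define m :: "'k \<Rightarrow> real" where "m j = (if j = i then \<eta> else 1)" for j
  define S :: "real ^ 'k \<Rightarrow> real ^ 'k" where "S x = (\<chi> j. m j * x $ j)" for x
  define \<Phi> where "\<Phi> x = S (T' x)" for x
  define \<Psi> where "\<Psi> z = T (\<chi> j. z $ j / m j)" for z
  have m0: "m j \<noteq> 0" for j using \<eta> by (simp add: m_def)
  have \<Psi>\<Phi>: "\<Psi> (\<Phi> x) = x" for x
    using m0 TT' by (simp add: \<Psi>_def \<Phi>_def S_def)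
  have comp: "T' u $ i = u \<bullet> v" for u
  proof -
    have "T' u $ i = T' u \<bullet> axis i 1" by (simp add: inner_axis)
    also have "\<dots> = T (T' u) \<bullet> T (axis i 1)" using T(1) by (simp add: orthogonal_transformation_def)
    finally show ?thesis using T(2) TT' by simp
  qed
  have T'v: "T' v = axis i 1" using T(2) bij unfolding T'_def by (metis bij_is_inj inv_f_f)
  have \<Phi>_diff: "\<Phi> y - \<Phi> x = S (T' (y - x))" for x y
    by (simp add: \<Phi>_def S_def vec_eq_iff linear_diff[OF linT'] right_diff_distrib)
  \<comment> \<open>Distances after \<open>\<Phi>\<close> dominate both parts of the hypothesis on
    \<open>f\<close>, so \<open>f\<close> composed with the inverse \<open>\<Psi>\<close> has
    constant \<open>1 + L\<close> at small scale.\<close>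
  have 1: "\<eta> * \<bar>(y - x) \<bullet> v\<bar> \<le> dist (\<Phi> x) (\<Phi> y)" for x y
  proof -
    have "\<eta> * \<bar>(y - x) \<bullet> v\<bar> = \<bar>S (T' (y - x)) $ i\<bar>"
      using \<eta> by (simp add: S_def m_def comp abs_mult)
    also have "\<dots> \<le> norm (\<Phi> y - \<Phi> x)" unfolding \<Phi>_diff by (rule component_le_norm_cart)
    finally show ?thesis by (simp add: dist_norm norm_minus_commute)
  qed
  have 2: "norm (y - x - ((y - x) \<bullet> v) *\<^sub>R v) \<le> dist (\<Phi> x) (\<Phi> y)" for x y
  proof -
    have "norm (y - x - ((y - x) \<bullet> v) *\<^sub>R v) = norm (T' (y - x - ((y - x) \<bullet> v) *\<^sub>R v))"
      using orthogonal_transformation_norm[OF T'] by simp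
    also have "T' (y - x - ((y - x) \<bullet> v) *\<^sub>R v) = T' (y - x) - (T' (y - x) $ i) *\<^sub>R axis i 1"
      by (simp add: linear_diff[OF linT', of "y - x"] linear_scale[OF linT'] T'v comp)
    also have "norm \<dots> \<le> norm (S (T' (y - x)))"
      by (rule norm_le_componentwise_cart) (auto simp: S_def m_def axis_def)
    also have "\<dots> = dist (\<Phi> x) (\<Phi> y)" by (simp add: \<Phi>_diff[symmetric] dist_norm norm_minus_commute)
    finally show ?thesis .
  qed
  \<comment> \<open>Distances shrink by no more than the factor \<open>\<eta> / 2\<close>, so points
    within \<open>\<eta> * \<rho> / 2\<close> after \<open>\<Phi>\<close> were within
    \<open>\<rho>\<close> before.\<close>
  have 3: "\<eta> * dist x y \<le> 2 * dist (\<Phi> x) (\<Phi> y)" for x y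
  proof -
    have "norm (y - x) \<le> norm (((y - x) \<bullet> v) *\<^sub>R v) + norm (y - x - ((y - x) \<bullet> v) *\<^sub>R v)"
      by (rule norm_triangle_sub)
    then have "dist x y \<le> \<bar>(y - x) \<bullet> v\<bar> + norm (y - x - ((y - x) \<bullet> v) *\<^sub>R v)"
      using v by (simp add: dist_norm norm_minus_commute)
    then have "\<eta> * dist x y \<le> \<eta> * \<bar>(y - x) \<bullet> v\<bar> + \<eta> * norm (y - x - ((y - x) \<bullet> v) *\<^sub>R v)"
      using \<eta> by (simp flip: distrib_left)
    also have "\<eta> * norm (y - x - ((y - x) \<bullet> v) *\<^sub>R v) \<le> 1 * norm (y - x - ((y - x) \<bullet> v) *\<^sub>R v)"
      using \<eta> by (intro mult_right_mono) auto
    finally show ?thesis using 1[of y x] 2[of y x] by linarith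
  qed
  have Psets: "P \<in> sets lebesgue" using P by blast
  \<comment> \<open>The covering bound refers to an open set, so \<open>P\<close> is enlarged to
    \<open>V\<close> at the cost of \<open>e\<close>.\<close>
  obtain V where V: "open V" "P \<subseteq> V" "V - P \<in> lmeasurable" "emeasure lebesgue (V - P) < ennreal e"
    using sets_lebesgue_outer_open[OF Psets e] by metis
  have VP: "V = P \<union> (V - P)" using V(2) by blast
  have Vm: "V \<in> lmeasurable" using fmeasurable.Un[OF P V(3)] VP by simp
  have "emeasure lebesgue V \<le> emeasure lebesgue P + emeasure lebesgue (V - P)"
    using VP emeasure_subadditive[of P lebesgue "V - P"] P V(3) by auto
  also have "\<dots> \<le> emeasure lebesgue P + ennreal e" using V(4) by (intro add_left_mono) auto
  finally have eV: "emeasure lborel V \<le> emeasure lebesgue P + ennreal e" using V(1) by simp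
  have openT'V: "open (T' ` V)"
    using orthogonal_transformation_bij[OF T'] linT' V(1)
    by (intro open_surjective_linear_image) (auto simp: bij_def)
  have T'V: "emeasure lborel (T' ` V) \<le> 10 ^ CARD('k) * emeasure lborel V"
    using emeasure_orthogonal_image_open_le[OF T' V(1)] by simp
  also have "\<dots> < top" using Vm V(1)
    by (auto simp: fmeasurable_def less_top[symmetric] ennreal_mult_eq_top_iff power_eq_top_ennreal)
  finally have T'Vm: "T' ` V \<in> lmeasurable" using openT'V by (auto simp: fmeasurable_def)
  define U where "U = \<Phi> ` V"
  have U_eq: "U = S ` T' ` V" by (auto simp: U_def \<Phi>_def)
  have "open U"
  proof -
    have "linear S" by (rule linearI) (auto simp: S_def vec_eq_iff algebra_simps)
    moreover have "surj S"
    proof (rule surjI)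
      show "S (\<chi> j. z $ j / m j) = z" for z using m0 by (simp add: S_def vec_eq_iff)
    qed
    ultimately show ?thesis unfolding U_eq by (rule open_surjective_linear_image[OF openT'V])
  qed
  \<comment> \<open>The determinant of the compression, and the source of the factor \<eta> in the
    bound.\<close>
  have "prod m UNIV = \<eta>"
    by (simp add: m_def)
  then have "measure lebesgue U = \<eta> * measure lebesgue (T' ` V)" "U \<in> lmeasurable"
    using measure_stretch[OF T'Vm, of m] measurable_stretch[OF T'Vm, of m] \<eta>
    by (simp_all add: U_eq S_def)
  then have "emeasure lebesgue U = ennreal \<eta> * emeasure lebesgue (T' ` V)"
    using T'Vm \<eta> by (simp only: emeasure_eq_measure2 ennreal_mult'[OF less_imp_le])
  then have "emeasure lborel U = ennreal \<eta> * emeasure lborel (T' ` V)"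
    using \<open>open U\<close> openT'V by simp
  also have "\<dots> \<le> ennreal \<eta> * (10 ^ CARD('k) * (emeasure lebesgue P + ennreal e))"
    by (intro mult_left_mono order_trans[OF T'V] eV) auto
  finally have eU: "emeasure lborel U \<le> ennreal \<eta> * (10 ^ CARD('k) * (emeasure lebesgue P + ennreal e))" .
  have "f ` P = (f \<circ> \<Psi>) ` (\<Phi> ` P)" by (force simp: \<Psi>\<Phi>)
  also have "hausdorff_measure DIM(real ^ 'k) \<dots> \<le> ennreal ((5 * (1 + L)) ^ DIM(real ^ 'k)) * emeasure lborel U"
  proof (rule hausdorff_measure_local_lipschitz_image_le[of _ _ "\<eta> * \<rho> / 2"])
    show "open U" by fact
    show "\<Phi> ` P \<subseteq> U" using V(2) by (auto simp: U_def)
    fix z w assume "z \<in> \<Phi> ` P" "w \<in> \<Phi> ` P" and zw: "dist z w < \<eta> * \<rho> / 2"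
    then obtain x y where xy: "x \<in> P" "y \<in> P" "z = \<Phi> x" "w = \<Phi> y" by blast
    have "\<eta> * dist x y < \<eta> * \<rho>" using 3[of x y] zw xy by simp
    then have "dist x y < \<rho>" using \<eta> by simp
    from f[OF xy(1,2) this]
    have "dist (f x) (f y) \<le> \<eta> * \<bar>(y - x) \<bullet> v\<bar> + L * norm (y - x - ((y - x) \<bullet> v) *\<^sub>R v)" .
    also have "\<dots> \<le> dist z w + L * dist z w"
      using 1[of y x] 2[of y x] L xy by (intro add_mono mult_left_mono) auto
    finally show "dist ((f \<circ> \<Psi>) z) ((f \<circ> \<Psi>) w) \<le> (1 + L) * dist z w"
      using xy by (simp add: \<Psi>\<Phi> algebra_simps)
  qed (use \<eta> \<rho> L in auto)
  also have "\<dots> \<le> ennreal ((5 * (1 + L)) ^ CARD('k)) * (ennreal \<eta> * (10 ^ CARD('k) * (emeasure lebesgue P + ennreal e)))"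
    using eU by (auto intro!: mult_left_mono)
  also have "\<dots> = ennreal ((5 * (1 + L)) ^ CARD('k) * (\<eta> * 10 ^ CARD('k))) * (emeasure lebesgue P + ennreal e)"
  proof -
    have "ennreal ((5 * (1 + L)) ^ CARD('k) * (\<eta> * 10 ^ CARD('k))) =
        ennreal ((5 * (1 + L)) ^ CARD('k)) * (ennreal \<eta> * ennreal (10 ^ CARD('k)))"
      using \<eta> L by (simp add: ennreal_mult)
    moreover have "ennreal (10 ^ CARD('k)) = 10 ^ CARD('k)"
      by (metis ennreal_numeral ennreal_power zero_le_numeral)
    ultimately show ?thesis by (simp only: mult.assoc)
  qed
  \<comment> \<open>The 5 is Vitali's enlargement, the 10 the crude bound for the volume of a
    rotated set.\<close>
  also have "(5 * (1 + L)) ^ CARD('k) * (\<eta> * 10 ^ CARD('k)) = (50 * (1 + L)) ^ CARD('k) * \<eta>"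
  proof -
    have "(50 * (1 + L)) ^ CARD('k) = (5 * (1 + L) * 10) ^ CARD('k)" by simp
    also have "\<dots> = (5 * (1 + L)) ^ CARD('k) * 10 ^ CARD('k)" by (rule power_mult_distrib)
    finally show ?thesis by simp
  qed
  finally show ?thesis by simp
qed

section \<open>Null images from a common kernel direction\<close>

text \<open>\<open>dist_le\<close> lets the scalar functions control distances of \<open>f\<close>:
  a contraction shared by all \<open>F i\<close> in a direction \<open>v\<close> becomes a
  contraction of \<open>f\<close>. The common kernel direction depends on \<open>x\<close>, while
  each piece needs a fixed one, hence the countable dense set \<open>T\<close> of
  directions.\<close>

lemma hausdorff_measure_image_eq_0_of_degenerate:
  fixes f :: "real ^ 'k::finite \<Rightarrow> 'a::metric_space"
    and F :: "'i::countable \<Rightarrow> real ^ 'k \<Rightarrow> real"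
  assumes E: "E \<in> sets lebesgue" and lip: "\<And>i. L-lipschitz_on UNIV (F i)"
    and lipf: "L-lipschitz_on E f"
    and dist_le: "\<And>x y c. x \<in> E \<Longrightarrow> y \<in> E \<Longrightarrow> (\<And>i. \<bar>F i x - F i y\<bar> \<le> c) \<Longrightarrow> dist (f x) (f y) \<le> c"
    and degenerate: "negligible {x \<in> E. \<not> (\<exists>w. norm w = 1 \<and>
      (\<forall>i. \<exists>D. (F i has_derivative D) (at x) \<and> D w = 0))}" (is "negligible ?bad")
  shows "hausdorff_measure CARD('k) (f ` E) = 0"
proof -
  have L: "0 \<le> L" using lip lipschitz_on_nonneg by blast
  have cF: "continuous_on UNIV (F i)" for i using lip lipschitz_on_continuous_on by blast
  obtain T :: "(real ^ 'k) set" where T: "countable T" "T \<subseteq> sphere 0 1" "sphere 0 1 \<subseteq> closure T"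
    using separable[of "sphere 0 1"] by metis
  have "axis undefined 1 \<in> sphere (0 :: real ^ 'k) 1" by (simp add: norm_axis_1)
  then have "T \<noteq> {}" using T(3) by auto
  \<comment> \<open>Finite measure matters: the bound will be \<open>K * \<eta> * M\<close> with
    \<eta> tending to 0.\<close>
  have bounded_part: "hausdorff_measure CARD('k) (f ` (E \<inter> ball 0 R)) = 0" for R
  proof -
    define B where "B = E \<inter> ball 0 R"
    have B: "B \<in> lmeasurable" "B \<subseteq> E" "B \<in> sets lebesgue"
      using fmeasurable_Int_fmeasurable[OF lmeasurable_ball E] E by (auto simp: B_def Int_commute)
    define K where "K = (50 * (1 + L)) ^ CARD('k)"
    define M where "M = measure lebesgue B + 1"
    have K: "0 \<le> K" using L by (simp add: K_def)
    have le: "hausdorff_measure CARD('k) (f ` B) \<le> ennreal (K * \<eta> * M)" if \<eta>: "0 < \<eta>" "\<eta> \<le> 1" for \<eta>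
    proof -
      \<comment> \<open>\<open>S\<close> allows half of \<eta> because uniformity in
        \<open>i\<close> doubles the bound, leaving \<eta> in \<open>A\<close>.\<close>
      define S where "S v = (\<Inter>i. \<Union>n::nat. right_slope_set (F i) v 0 (\<eta> / 2) (1 / Suc n))" for v
      define A where "A v n = (\<Inter>i. right_slope_set (F i) v 0 (2 * (\<eta> / 2)) (1 / real (Suc n)))" for v and n :: nat
      have A: "A v n \<in> sets lebesgue" for v n
        unfolding A_def using closed_right_slope_set[OF cF] by (intro sets.countable_INT'') (auto simp: borel_closed)
      \<comment> \<open>Pairs of a direction and a scale are enumerated and the pieces made
        disjoint, so that their measures add up to at most that of \<open>B\<close>.\<close>
      define g where "g = from_nat_into (T \<times> (UNIV :: nat set))"
      have g: "range g = T \<times> UNIV" unfolding g_def using \<open>T \<noteq> {}\<close> T(1) by (intro range_from_nat_into) auto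
      define A' where "A' j = B \<inter> case_prod A (g j)" for j
      have A': "range A' \<subseteq> sets lebesgue" using A B by (auto simp: A'_def case_prod_unfold)
      define P where "P = disjointed A'"
      have P: "P j \<in> sets lebesgue" "P j \<subseteq> A' j" for j
        using sets.range_disjointed_sets[OF A'] by (auto simp: P_def disjointed_def)
      have UP: "(\<Union>j. P j) = (\<Union>j. A' j)" unfolding P_def by (rule UN_disjointed_eq)
      have UPB: "(\<Union>j. P j) \<subseteq> B" unfolding UP by (auto simp: A'_def)
      have "negligible (S v - (\<Union>n. A v n))" for v
        unfolding S_def A_def by (rule negligible_nonuniform_slopes[OF lip]) (use \<eta> in simp)
      then have "negligible (?bad \<union> (\<Union>v\<in>T. S v - (\<Union>n. A v n)))"
        by (intro negligible_Un degenerate negligible_countable_Union countable_image T) auto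
      moreover have "B - (\<Union>j. P j) \<subseteq> ?bad \<union> (\<Union>v\<in>T. S v - (\<Union>n. A v n))"
      proof
        fix x assume x: "x \<in> B - (\<Union>j. P j)"
        show "x \<in> ?bad \<union> (\<Union>v\<in>T. S v - (\<Union>n. A v n))"
        proof (cases "x \<in> ?bad")
          case False
          then obtain w where w: "norm w = 1" "\<And>i. \<exists>D. (F i has_derivative D) (at x) \<and> D w = 0"
            using x B by blast
          have "w \<in> closure T" using w T by auto
          moreover have "0 < \<eta> / (4 * (L + 1))" using \<eta> L by simp
          ultimately obtain v where v: "v \<in> T" "dist v w < \<eta> / (4 * (L + 1))"
            unfolding closure_approachable by blast
          \<comment> \<open>The bound \<open>\<eta> / 2\<close> in \<open>S v\<close> is split
            evenly: one quarter of \<eta> for turning \<open>w\<close> into \<open>v\<close>, one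
            for the remainder in the derivative of \<open>F i\<close>.\<close>
          have "L * dist v w \<le> (L + 1) * (\<eta> / (4 * (L + 1)))"
            using v L by (intro mult_mono) auto
          also have "\<dots> = \<eta> / 4" using L by (simp add: field_simps)
          finally have Lvw: "L * dist v w \<le> \<eta> / 4" .
          have "x \<in> S v" unfolding S_def
          proof (rule INT_I)
            fix i
            obtain D where D: "(F i has_derivative D) (at x)" "D w = 0" using w by blast
            have linD: "linear D" using D(1) has_derivative_linear by blast
            have "0 < \<eta> / 4" using \<eta> by simp
            with D(1) obtain d where d: "0 < d"
              "\<And>y. norm (y - x) < d \<Longrightarrow> norm (F i y - F i x - D (y - x)) \<le> \<eta> / 4 * norm (y - x)"
              unfolding has_derivative_at_alt by blast
            obtain n :: nat where n: "1 / Suc n < d" using d(1) nat_approx_posE[of d] by auto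
            have "x \<in> right_slope_set (F i) v 0 (\<eta> / 2) (1 / Suc n)"
              unfolding right_slope_set_def
            proof (intro CollectI ballI)
              fix h assume "h \<in> {0<..<1 / real (Suc n)}"
              then have h: "0 < h" "h < d" using n by auto
              have "\<bar>F i (x + h *\<^sub>R w) - F i x\<bar> \<le> \<eta> / 4 * h"
                using d(2)[of "x + h *\<^sub>R w"] h w(1) D(2) linear_scale[OF linD, of h w] by simp
              moreover have "\<bar>F i (x + h *\<^sub>R v) - F i (x + h *\<^sub>R w)\<bar> \<le> \<eta> / 4 * h"
              proof -
                have "\<bar>F i (x + h *\<^sub>R v) - F i (x + h *\<^sub>R w)\<bar> \<le> L * dist (x + h *\<^sub>R v) (x + h *\<^sub>R w)"
                  using lipschitz_onD[OF lip[of i] UNIV_I UNIV_I] unfolding dist_real_def .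
                also have "\<dots> = (L * dist v w) * h"
                  using h by (simp add: dist_norm flip: scaleR_diff_right)
                also have "\<dots> \<le> \<eta> / 4 * h" using Lvw h by (intro mult_right_mono) auto
                finally show ?thesis .
              qed
              ultimately show "\<bar>F i (x + h *\<^sub>R v) - F i x - 0 * h\<bar> \<le> \<eta> / 2 * h" by linarith
            qed
            then show "x \<in> (\<Union>n::nat. right_slope_set (F i) v 0 (\<eta> / 2) (1 / Suc n))" by blast
          qed
          moreover have "x \<notin> A v n" for n
          proof
            assume "x \<in> A v n"
            have "(v, n) \<in> range g" using g v(1) by blast
            then obtain j where "g j = (v, n)" by (metis imageE)
            then have "x \<in> A' j" using x \<open>x \<in> A v n\<close> by (simp add: A'_def)
            then show False using x UP by blast
          qed
          ultimately show ?thesis using v(1) by blast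
        qed blast
      qed
      ultimately have neg: "negligible (B - (\<Union>j. P j))" by (rule negligible_subset)
      have "hausdorff_measure DIM(real ^ 'k) (f ` (B - (\<Union>j. P j))) = 0"
        using B(2) by (intro hausdorff_measure_lipschitz_image_negligible[OF lipschitz_on_subset[OF lipf] neg]) auto
      then have 0: "hausdorff_measure CARD('k) (f ` (B - (\<Union>j. P j))) = 0" by simp
      \<comment> \<open>The excess \<open>(1/2) ^ Suc j\<close> allowed in enlarging
        \<open>P j\<close> sums to 1, which is the summand 1 in \<open>M\<close>.\<close>
      have Pj: "hausdorff_measure CARD('k) (f ` P j)
          \<le> ennreal (K * \<eta>) * (emeasure lebesgue (P j) + ennreal ((1/2) ^ Suc j))" for j
      proof -
        obtain v n where gj: "g j = (v, n)" by (cases "g j")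
        then have "v \<in> T" using g by (metis mem_Sigma_iff rangeI)
        then have v: "norm v = 1" using T(2) by auto
        have PA: "P j \<subseteq> A v n" "P j \<subseteq> E" using P(2)[of j] gj B(2) by (auto simp: A'_def)
        have PB: "P j \<subseteq> B" using UPB by blast
        have Pm: "P j \<in> lmeasurable" using B(1) P(1) PB by (metis fmeasurable_Int_fmeasurable inf.absorb_iff2)
        \<comment> \<open>From \<open>x\<close> move along \<open>v\<close> by \<open>s\<close>,
          where the slope set gives rate \<eta>, then transversally to \<open>y\<close>, where only
          the constant \<open>L\<close> is available.\<close>
        have slope: "\<bar>F i x - F i y\<bar> \<le> \<eta> * \<bar>(y - x) \<bullet> v\<bar> + L * norm (y - x - ((y - x) \<bullet> v) *\<^sub>R v)"
          if xy: "x \<in> P j" "dist x y < 1 / Suc n" "0 < (y - x) \<bullet> v" for x y i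
        proof -
          define s where "s = (y - x) \<bullet> v"
          have "s \<le> norm (y - x) * norm v" unfolding s_def by (rule norm_cauchy_schwarz)
          then have s: "s \<in> {0<..<1 / real (Suc n)}" using xy v by (simp add: s_def dist_norm norm_minus_commute)
          have "x \<in> right_slope_set (F i) v 0 \<eta> (1 / real (Suc n))"
            using xy(1) PA(1) by (auto simp: A_def)
          then have "\<bar>F i (x + s *\<^sub>R v) - F i x - 0 * s\<bar> \<le> \<eta> * s"
            using s unfolding right_slope_set_def by blast
          moreover have "\<bar>F i y - F i (x + s *\<^sub>R v)\<bar> \<le> L * norm (y - x - s *\<^sub>R v)"
            using lipschitz_onD[OF lip[of i], of y "x + s *\<^sub>R v"]
            by (simp add: dist_real_def dist_norm diff_diff_eq)
          moreover have "\<bar>s\<bar> = s" using s by simp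
          ultimately show ?thesis unfolding s_def[symmetric] by linarith
        qed
        show ?thesis
          unfolding K_def
        proof (rule hausdorff_measure_image_compressed_direction[OF Pm \<eta> L _ v])
          show "0 < 1 / real (Suc n)" "(0::real) < (1/2) ^ Suc j" by simp_all
          fix x y assume xy: "x \<in> P j" "y \<in> P j" "dist x y < 1 / real (Suc n)"
          have sym: "(x - y) \<bullet> v = - ((y - x) \<bullet> v)" by (simp add: inner_diff_left)
          have sym': "norm (x - y - ((x - y) \<bullet> v) *\<^sub>R v) = norm (y - x - ((y - x) \<bullet> v) *\<^sub>R v)"
            using norm_minus_cancel[of "y - x - ((y - x) \<bullet> v) *\<^sub>R v"] unfolding sym by (simp add: algebra_simps)
          show "dist (f x) (f y) \<le> \<eta> * \<bar>(y - x) \<bullet> v\<bar> + L * norm (y - x - ((y - x) \<bullet> v) *\<^sub>R v)"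
          proof (rule dist_le)
            show "x \<in> E" "y \<in> E" using xy PA by auto
            fix i
            \<comment> \<open>Slope sets look forward only, so the point with the smaller component
              along \<open>v\<close> is the starting point; for equal components the displacement is
              purely transversal.\<close>
            consider "0 < (y - x) \<bullet> v" | "0 < (x - y) \<bullet> v" | "(y - x) \<bullet> v = 0" using sym by linarith
            then show "\<bar>F i x - F i y\<bar> \<le> \<eta> * \<bar>(y - x) \<bullet> v\<bar> + L * norm (y - x - ((y - x) \<bullet> v) *\<^sub>R v)"
            proof cases
              case 1
              then show ?thesis by (rule slope[OF xy(1,3)])
            next
              case 2
              have "\<bar>F i y - F i x\<bar> \<le> \<eta> * \<bar>(x - y) \<bullet> v\<bar> + L * norm (x - y - ((x - y) \<bullet> v) *\<^sub>R v)"
                by (rule slope[OF xy(2) _ 2]) (use xy in \<open>simp add: dist_commute\<close>)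
              then show ?thesis unfolding sym' unfolding sym by (simp add: abs_minus_commute)
            next
              case 3
              then show ?thesis using lipschitz_onD[OF lip[of i], of x y]
                by (simp add: dist_real_def dist_norm norm_minus_commute)
            qed
          qed
        qed
      qed
      have "f ` B = f ` (B - (\<Union>j. P j)) \<union> (\<Union>j. f ` P j)" using UPB by blast
      then have "hausdorff_measure CARD('k) (f ` B)
          \<le> hausdorff_measure CARD('k) (f ` (B - (\<Union>j. P j))) + hausdorff_measure CARD('k) (\<Union>j. f ` P j)"
        using hausdorff_measure_Un[of "CARD('k)"] by simp
      also have "\<dots> \<le> (\<Sum>j. hausdorff_measure CARD('k) (f ` P j))"
        unfolding 0 using hausdorff_measure_countably_subadditive by simp
      also have "\<dots> \<le> (\<Sum>j. ennreal (K * \<eta>) * (emeasure lebesgue (P j) + ennreal ((1/2) ^ Suc j)))"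
        by (intro suminf_le Pj) auto
      also have "\<dots> = ennreal (K * \<eta>) * (\<Sum>j. emeasure lebesgue (P j) + ennreal ((1/2) ^ Suc j))"
        by (rule ennreal_suminf_cmult)
      also have "(\<Sum>j. emeasure lebesgue (P j) + ennreal ((1/2) ^ Suc j))
          = (\<Sum>j. emeasure lebesgue (P j)) + (\<Sum>j. ennreal ((1/2) ^ Suc j))"
        by (rule suminf_add[symmetric]) auto
      also have "(\<Sum>j. ennreal ((1/2) ^ Suc j)) = ennreal 1"
        by (rule suminf_ennreal_eq[OF _ power_half_series]) simp
      also have "(\<Sum>j. emeasure lebesgue (P j)) = emeasure lebesgue (\<Union>j. P j)"
        unfolding P_def using sets.range_disjointed_sets[OF A']
        by (intro suminf_emeasure disjoint_family_disjointed) auto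
      also have "\<dots> \<le> emeasure lebesgue B" using UPB B(3) by (rule emeasure_mono)
      also have "emeasure lebesgue B + ennreal 1 = ennreal M"
        using B(1) by (simp add: M_def emeasure_eq_measure2 del: ennreal_1)
      finally have "hausdorff_measure CARD('k) (f ` B) \<le> ennreal (K * \<eta>) * ennreal M"
        by (simp add: add_right_mono mult_left_mono)
      moreover have "0 \<le> M" by (simp add: M_def)
      ultimately show ?thesis using K \<eta> by (simp add: ennreal_mult)
    qed
    have "hausdorff_measure CARD('k) (f ` B) \<le> 0 + ennreal e" if "0 < e" for e
    proof -
      have M: "0 < M" by (simp add: M_def add_nonneg_pos)
      define \<eta> where "\<eta> = min 1 (e / (K * M + 1))"
      have pos: "0 < K * M + 1" using K M by (simp add: add_nonneg_pos)
      have \<eta>: "0 < \<eta>" "\<eta> \<le> 1" "\<eta> \<le> e / (K * M + 1)" using that pos by (auto simp: \<eta>_def)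
      have "K * \<eta> * M = (K * M) * \<eta>" by simp
      also have "\<dots> \<le> (K * M + 1) * (e / (K * M + 1))"
        using \<eta> K M by (intro mult_mono) auto
      also have "\<dots> = e" using pos by simp
      finally have "ennreal (K * \<eta> * M) \<le> ennreal e" by (rule ennreal_leI)
      then show ?thesis using le[OF \<eta>(1,2)] by (simp add: order_trans)
    qed
    then have "hausdorff_measure CARD('k) (f ` B) \<le> 0" by (rule ennreal_le_epsilon)
    then show ?thesis by (simp add: B_def)
  qed
  have "E = (\<Union>n::nat. E \<inter> ball 0 (real n))"
  proof -
    have "\<exists>n::nat. x \<in> ball 0 (real n)" for x :: "real ^ 'k" using reals_Archimedean2 by simp
    then show ?thesis by blast
  qed
  then have "f ` E = (\<Union>n::nat. f ` (E \<inter> ball 0 (real n)))" by blast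
  then have "hausdorff_measure CARD('k) (f ` E) \<le> (\<Sum>n::nat. hausdorff_measure CARD('k) (f ` (E \<inter> ball 0 (real n))))"
    using hausdorff_measure_countably_subadditive[of "CARD('k)" "\<lambda>n. f ` (E \<inter> ball 0 (real n))"] by simp
  then show ?thesis by (simp add: bounded_part)
qed

section \<open>Null images under injective derivatives\<close>

lemma negligible_of_injective_derivative:
  fixes G :: "'n::euclidean_space \<Rightarrow> 'n"
  assumes img: "negligible (G ` S)"
    and deriv: "\<And>x. x \<in> S \<Longrightarrow> \<exists>D. (G has_derivative D) (at x) \<and> inj D"
  shows "negligible S"
proof -
  \<comment> \<open>One index bounds both the radius and the expansion constant, so countably many
    sets exhaust \<open>S\<close>.\<close>
  define S' where "S' n = {x \<in> S. \<forall>y. dist y x < 1 / Suc n \<longrightarrow> dist y x \<le> Suc n * dist (G y) (G x)}" for n :: nat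
  have "negligible (S' n)" for n
    unfolding locally_negligible_alt[of "S' n"]
  proof
    fix c assume "c \<in> S' n"
    \<comment> \<open>Half the radius, so that any two points of \<open>U\<close> are within
      \<open>1 / Suc n\<close> of each other.\<close>
    define U where "U = S' n \<inter> ball c (1 / (2 * Suc n))"
    have close: "dist y x \<le> Suc n * dist (G y) (G x)" if "x \<in> U" "y \<in> U" for x y
    proof -
      have "dist y x \<le> dist c y + dist c x" by (rule dist_triangle3)
      also have "\<dots> < 1 / (2 * Suc n) + 1 / (2 * Suc n)" using that by (intro add_strict_mono) (auto simp: U_def)
      also have "\<dots> = 1 / Suc n" by (simp add: field_simps)
      finally show ?thesis using that by (auto simp: U_def S'_def)
    qed
    have "inj_on G U"
    proof (rule inj_onI)
      fix x y assume "x \<in> U" "y \<in> U" "G x = G y"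
      then show "x = y" using close[of x y] by simp
    qed
    define H where "H = inv_into U G"
    have H: "H (G x) = x" if "x \<in> U" for x unfolding H_def using \<open>inj_on G U\<close> that by (rule inv_into_f_f)
    have "negligible (H ` (G ` U))"
    proof (rule negligible_locally_Lipschitz_image)
      show "negligible (G ` U)" using img by (rule negligible_subset) (auto simp: U_def S'_def)
      fix z assume "z \<in> G ` U"
      then have "\<forall>w\<in>G ` U \<inter> UNIV. norm (H w - H z) \<le> Suc n * norm (w - z)"
        using close by (auto simp: H dist_norm)
      then show "\<exists>T B. open T \<and> z \<in> T \<and> (\<forall>w\<in>G ` U \<inter> T. norm (H w - H z) \<le> B * norm (w - z))"
        by (intro exI[of _ UNIV]) auto
    qed simp
    moreover have "H ` (G ` U) = U" by (force simp: H)
    moreover have "openin (top_of_set (S' n)) U" unfolding U_def by (simp add: openin_open_Int)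
    moreover have "c \<in> U" using \<open>c \<in> S' n\<close> by (simp add: U_def)
    ultimately show "\<exists>U. openin (top_of_set (S' n)) U \<and> c \<in> U \<and> negligible U" by auto
  qed
  then have "negligible (\<Union>n. S' n)" by (intro negligible_countable_Union) auto
  moreover have "S \<subseteq> (\<Union>n. S' n)"
  proof
    fix x assume x: "x \<in> S"
    then obtain D where D: "(G has_derivative D) (at x)" "inj D" using deriv by blast
    have "linear D" using D(1) has_derivative_linear by blast
    then obtain b where b: "0 < b" "\<And>u. b * norm u \<le> norm (D u)"
      using linear_inj_bounded_below_pos[OF _ D(2)] by metis
    \<comment> \<open>An error of half the lower bound \<open>b\<close> of the derivative leaves an
      expansion by \<open>b / 2\<close>.\<close>
    obtain d where d: "0 < d" "\<And>y. norm (y - x) < d \<Longrightarrow> norm (G y - G x - D (y - x)) \<le> b / 2 * norm (y - x)"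
      using D(1) b(1) half_gt_zero[OF b(1)] unfolding has_derivative_at_alt by blast
    obtain n1 :: nat where n1: "1 / Suc n1 < d" using d(1) nat_approx_posE[of d] by auto
    obtain n2 :: nat where n2: "1 / Suc n2 < b / 2" using b(1) nat_approx_posE[of "b / 2"] by auto
    define n where "n = max n1 n2"
    have n: "1 / Suc n < d" "1 / Suc n < b / 2"
    proof -
      have "1 / real (Suc n) \<le> 1 / Suc n1" "1 / real (Suc n) \<le> 1 / Suc n2"
        by (auto simp: n_def intro!: divide_left_mono)
      then show "1 / Suc n < d" "1 / Suc n < b / 2" using n1 n2 by linarith+
    qed
    have "dist y x \<le> Suc n * dist (G y) (G x)" if "dist y x < 1 / Suc n" for y
    proof -
      have "norm (G y - G x - D (y - x)) \<le> b / 2 * norm (y - x)"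
        using that n by (intro d) (simp add: dist_norm)
      then have "b / 2 * norm (y - x) \<le> norm (G y - G x)"
        using b(2)[of "y - x"] norm_triangle_ineq2[of "D (y - x)" "G y - G x"]
        by (simp add: norm_minus_commute)
      moreover have "1 / Suc n * norm (y - x) \<le> b / 2 * norm (y - x)"
        using n by (intro mult_right_mono) auto
      ultimately have "1 / Suc n * norm (y - x) \<le> norm (G y - G x)" by linarith
      then show ?thesis by (simp add: dist_norm divide_le_eq mult.commute)
    qed
    then have "x \<in> S' n" using x by (simp add: S'_def)
    then show "x \<in> (\<Union>n. S' n)" by blast
  qed
  ultimately show ?thesis by (rule negligible_subset)
qed

section \<open>Distance projections and the equivalences\<close>

lemma projection_at_eq_image:
  "projection_at y f ` E = (\<lambda>p. \<chi> i. dist p (y i)) ` f ` E"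
  by (auto simp: projection_at_def image_image)

lemma lipschitz_on_distances:
  fixes y :: "'k::finite \<Rightarrow> 'a::metric_space"
  shows "(real CARD('k))-lipschitz_on UNIV (\<lambda>p. \<chi> i. dist p (y i))"
proof (rule lipschitz_onI)
  fix p q :: 'a
  have "norm ((\<chi> i. dist p (y i)) - (\<chi> i. dist q (y i)) :: real ^ 'k) \<le> (\<Sum>i\<in>UNIV. \<bar>dist p (y i) - dist q (y i)\<bar>)"
    using norm_le_l1_cart[of "(\<chi> i. dist p (y i)) - (\<chi> i. dist q (y i)) :: real ^ 'k"] by simp
  also have "\<dots> \<le> (\<Sum>i\<in>(UNIV :: 'k set). dist p q)"
    using abs_dist_diff_le[of p _ q] by (intro sum_mono) (simp add: dist_commute[of _ q])
  finally show "dist (\<chi> i. dist p (y i)) ((\<chi> i. dist q (y i)) :: real ^ 'k) \<le> real CARD('k) * dist p q"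
    by (simp add: dist_norm)
qed simp

text \<open>If the span of the gradients were everything, one could choose \<open>k\<close> independent ones, and
  the corresponding \<open>k\<close>-tuple would have full rank.\<close>

lemma common_kernel_of_degenerate_tuples:
  fixes D :: "'i \<Rightarrow> real ^ 'k::finite \<Rightarrow> real"
  assumes lin: "\<And>i. linear (D i)"
    and degenerate: "\<And>\<iota> :: 'k \<Rightarrow> 'i. inj (D \<circ> \<iota>) \<Longrightarrow> rank (matrix (\<lambda>v. \<chi> j. D (\<iota> j) v)) < CARD('k)"
  shows "\<exists>w. norm w = 1 \<and> (\<forall>i. D i w = 0)"
proof -
  \<comment> \<open>\<open>a i\<close> is the gradient representing the functional
    \<open>D i\<close>.\<close>
  define a where "a i = (\<Sum>b\<in>Basis. D i b *\<^sub>R b)" for i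
  have Da: "D i v = a i \<bullet> v" for i v
  proof -
    have "D i v = D i (\<Sum>b\<in>Basis. (v \<bullet> b) *\<^sub>R b)" by (simp add: euclidean_representation)
    also have "\<dots> = (\<Sum>b\<in>Basis. (v \<bullet> b) * D i b)"
      using lin[of i] by (simp add: linear_sum linear_scale)
    finally show ?thesis by (simp add: a_def inner_sum_left inner_commute[of v] mult.commute)
  qed
  have "\<exists>w. w \<noteq> 0 \<and> (\<forall>i. a i \<bullet> w = 0)"
  proof -
    obtain B where B: "B \<subseteq> range a" "independent B" "range a \<subseteq> span B" "card B = dim (range a)"
      by (rule basis_exists)
    have finB: "finite B" using B(2) by (rule independent_imp_finite)
    show ?thesis
    proof (cases "card B = CARD('k)")
      case False
      then have "dim (range a) < DIM(real ^ 'k)"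
        using B(4) dim_subset_UNIV[of "range a"] by simp
      then obtain w where w: "w \<noteq> 0" "span (range a) \<subseteq> {x. w \<bullet> x = 0}"
        using lowdim_subset_hyperplane by blast
      then have "a i \<bullet> w = 0" for i
        using span_base[of "a i" "range a"] by (auto simp: inner_commute)
      then show ?thesis using w(1) by blast
    next
      case True
      then obtain \<beta> where \<beta>: "bij_betw \<beta> (UNIV :: 'k set) B"
        using finite_same_card_bij[OF finite finB, of "UNIV :: 'k set"] by auto
      have "\<exists>i. a i = \<beta> j" for j using bij_betwE[OF \<beta>] B(1) by (metis UNIV_I imageE subsetD)
      then obtain \<iota> where \<iota>: "\<And>j. a (\<iota> j) = \<beta> j" by metis
      \<comment> \<open>The basis vectors \<open>\<beta> j\<close> are distinct, hence so are the
        functionals; \<open>degenerate\<close> covers just such tuples.\<close>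
      have "inj (D \<circ> \<iota>)"
      proof (rule injI)
        fix j j' assume "(D \<circ> \<iota>) j = (D \<circ> \<iota>) j'"
        then have "\<beta> j = \<beta> j'" by (simp add: a_def flip: \<iota>)
        then show "j = j'" using \<beta> by (auto simp: bij_betw_def inj_on_def)
      qed
      then have "\<not> inj ((*v) (matrix (\<lambda>v. \<chi> j. D (\<iota> j) v)))"
        using degenerate less_rank_noninjective by blast
      moreover have "linear (\<lambda>v. \<chi> j. D (\<iota> j) v)"
        using lin by (auto intro!: linearI simp: vec_eq_iff linear_add linear_scale)
      ultimately have "\<not> inj (\<lambda>v. \<chi> j. D (\<iota> j) v)" "linear (\<lambda>v. \<chi> j. D (\<iota> j) v)"
        by simp_all
      then obtain w where w: "(\<chi> j. D (\<iota> j) w) = 0" "w \<noteq> 0"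
        using linear_injective_0 by blast
      have "w \<bullet> x = 0" if xB: "x \<in> B" for x
      proof -
        obtain j where "x = \<beta> j" using \<beta> xB by (auto simp: bij_betw_def)
        moreover have "D (\<iota> j) w = 0" using w(1) by (simp add: vec_eq_iff)
        ultimately show ?thesis using \<iota>[of j] by (simp add: Da inner_commute)
      qed
      then have "B \<subseteq> {x. w \<bullet> x = 0}" by blast
      then have "span B \<subseteq> {x. w \<bullet> x = 0}" by (intro span_minimal subspace_hyperplane)
      with B(3) have "range a \<subseteq> {x. w \<bullet> x = 0}" by (rule subset_trans)
      then have "a i \<bullet> w = 0" for i by (auto simp: inner_commute[of _ w])
      then show ?thesis using w(2) by blast
    qed
  qed
  then obtain w where w: "w \<noteq> 0" "\<And>i. a i \<bullet> w = 0" by blast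
  then show ?thesis by (intro exI[of _ "sgn w"]) (auto simp: Da norm_sgn sgn_div_norm)
qed

text \<open>As \<open>ap_deriv\<close> is a definite description, a rank bound alone would be
  arbitrary where no approximate derivative exists; hence the differentiability clause in (4), which
  holds almost everywhere on \<open>E\<close>.\<close>

theorem theorem1p1:
  fixes E :: "(real ^ 'k::finite) set"
    and f :: "real ^ 'k \<Rightarrow> 'a::metric_space"
  assumes "E \<in> sets lebesgue"
    and "\<exists>C. C-lipschitz_on E f"
  shows
    "(hausdorff_measure CARD('k) (f ` E) = 0 \<longleftrightarrow>
        (\<forall>\<phi> :: 'a \<Rightarrow> real ^ 'k. (\<exists>C. C-lipschitz_on UNIV \<phi>) \<longrightarrow>
           hausdorff_measure CARD('k) (\<phi> ` f ` E) = 0)) \<and>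
     (hausdorff_measure CARD('k) (f ` E) = 0 \<longleftrightarrow>
        (\<forall>y :: 'k \<Rightarrow> 'a. inj y \<longrightarrow>
           hausdorff_measure CARD('k) (projection_at y f ` E) = 0)) \<and>
     (hausdorff_measure CARD('k) (f ` E) = 0 \<longleftrightarrow>
        (\<forall>y :: 'k \<Rightarrow> 'a. inj y \<longrightarrow>
           hausdorff_measure CARD('k)
             {x \<in> E. \<not> (ap_differentiable E (projection_at y f) x \<and>
                       rank (ap_jacobian E (projection_at y f) x) < CARD('k))} = 0))"
proof -
  obtain L where L: "L-lipschitz_on E f" using assms(2) by blast
  have null_iff: "hausdorff_measure CARD('k) S = 0 \<longleftrightarrow> negligible S" for S :: "(real ^ 'k) set"
    using hausdorff_measure_eq_0_iff_negligible[of S] by simp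
  have "\<exists>F. L-lipschitz_on UNIV F \<and> (\<forall>x\<in>E. F x = dist (f x) z)" for z
  proof (rule lipschitz_extend_real)
    show "L-lipschitz_on E (\<lambda>x. dist (f x) z)"
    proof (rule lipschitz_onI)
      show "dist (dist (f x) z) (dist (f y) z) \<le> L * dist x y" if "x \<in> E" "y \<in> E" for x y
        using lipschitz_onD[OF L that] abs_dist_diff_le[of "f x" z "f y"]
        by (simp add: dist_real_def dist_commute[of z])
    qed (rule lipschitz_on_nonneg[OF L])
  qed
  then obtain F where F: "\<And>z. L-lipschitz_on UNIV (F z)" "\<And>z x. x \<in> E \<Longrightarrow> F z x = dist (f x) z"
    by metis
  define D where "D z x = frechet_derivative (F z) (at x)" for z x
  \<comment> \<open>At points of \<open>E\<close> outside this null set, the approximate derivatives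
    of the projection are the derivatives of the extensions.\<close>
  define N where "N y = {x \<in> E. \<not> density_point x E} \<union> (\<Union>i. {x. \<not> F (y i) differentiable (at x)})"
    for y :: "'k \<Rightarrow> 'a"
  have negN: "negligible (N y)" for y
    unfolding N_def using negligible_non_density_points[OF assms(1)] rademacher[OF F(1)]
    by (intro negligible_Un negligible_countable_Union) auto
  have D: "(F (y i) has_derivative D (y i) x) (at x)" if "x \<notin> N y" for x y i
    using that unfolding D_def N_def by (simp add: frechet_derivative_works[symmetric])
  have jac: "ap_differentiable E (projection_at y f) x"
    "ap_jacobian E (projection_at y f) x = matrix (\<lambda>v. \<chi> i. D (y i) x v)"
    if "x \<in> E" "x \<notin> N y" for x y
  proof -
    have iff: "has_ap_derivative E (\<lambda>x. projection_at y f x $ i) x M \<longleftrightarrow> M = D (y i) x" for i M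
    proof (rule has_ap_derivative_iff_eq_derivative[OF assms(1) that(1)])
      show "density_point x E" using that by (auto simp: N_def)
      show "(F (y i) has_derivative D (y i) x) (at x)" using D that(2) .
    qed (simp add: projection_at_def F)
    show "ap_differentiable E (projection_at y f) x"
      unfolding ap_differentiable_def iff by blast
    show "ap_jacobian E (projection_at y f) x = matrix (\<lambda>v. \<chi> i. D (y i) x v)"
      unfolding ap_jacobian_def ap_deriv_def iff by simp
  qed
  let ?bad = "\<lambda>y. {x \<in> E. \<not> (ap_differentiable E (projection_at y f) x \<and>
    rank (ap_jacobian E (projection_at y f) x) < CARD('k))}"
  let ?P1 = "hausdorff_measure CARD('k) (f ` E) = 0"
  let ?P2 = "\<forall>\<phi> :: 'a \<Rightarrow> real ^ 'k. (\<exists>C. C-lipschitz_on UNIV \<phi>) \<longrightarrow>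
    hausdorff_measure CARD('k) (\<phi> ` f ` E) = 0"
  let ?P3 = "\<forall>y :: 'k \<Rightarrow> 'a. inj y \<longrightarrow> hausdorff_measure CARD('k) (projection_at y f ` E) = 0"
  let ?P4 = "\<forall>y :: 'k \<Rightarrow> 'a. inj y \<longrightarrow> hausdorff_measure CARD('k) (?bad y) = 0"
  have 12: "?P1 \<Longrightarrow> ?P2"
    using hausdorff_measure_lipschitz_image_eq_0 lipschitz_on_subset subset_UNIV by metis
  have 23: "?P2 \<Longrightarrow> ?P3"
    unfolding projection_at_eq_image using lipschitz_on_distances by blast
  have 34: "?P4" if P3: "?P3"
  proof (intro allI impI)
    fix y :: "'k \<Rightarrow> 'a" assume "inj y"
    then have null: "negligible (projection_at y f ` E)" using P3 null_iff by blast
    define G where "G x = (\<chi> i. F (y i) x)" for x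
    \<comment> \<open>Off \<open>N y\<close>, belonging to \<open>?bad y\<close> can only mean full
      rank, that is, an injective derivative of \<open>G\<close>.\<close>
    define S where "S = ?bad y - N y"
    have "negligible S"
    proof (rule negligible_of_injective_derivative)
      show "negligible (G ` S)"
      proof (rule negligible_subset[OF null])
        show "G ` S \<subseteq> projection_at y f ` E"
          using F(2) by (force simp: G_def S_def projection_at_def)
      qed
      fix x assume "x \<in> S"
      then have x: "x \<in> E" "x \<notin> N y" "x \<in> ?bad y" by (auto simp: S_def)
      have "(G has_derivative (\<lambda>v. \<chi> i. D (y i) x v)) (at x)"
        using D[OF x(2)] unfolding G_def
        by (subst has_derivative_componentwise_within) (auto simp: Basis_vec_def inner_axis)
      moreover from this have "linear (\<lambda>v. \<chi> i. D (y i) x v)" by (rule has_derivative_linear)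
      moreover have "\<not> rank (matrix (\<lambda>v. \<chi> i. D (y i) x v)) < CARD('k)"
        using x jac[OF x(1,2)] by auto
      ultimately show "\<exists>M. (G has_derivative M) (at x) \<and> inj M"
        unfolding less_rank_noninjective by auto
    qed
    then have "negligible (S \<union> N y)" using negN by (rule negligible_Un)
    then show "hausdorff_measure CARD('k) (?bad y) = 0"
      unfolding null_iff by (rule negligible_subset) (auto simp: S_def)
  qed
  have 41: "?P1" if "?P4"
  proof (cases "E = {}")
    case True
    then show ?thesis
      using hausdorff_measure_lipschitz_image_negligible[OF L] by simp
  next
    case False
    \<comment> \<open>\<open>X\<close> may be inseparable, so the points \<open>z n\<close> are
      images of a countable dense subset of \<open>E\<close>.\<close>
    obtain T where T: "countable T" "T \<subseteq> E" "E \<subseteq> closure T" by (rule separable)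
    have "T \<noteq> {}" using False T(3) by auto
    define z where "z n = f (from_nat_into T n)" for n
    show ?thesis
    proof (rule hausdorff_measure_image_eq_0_of_degenerate[OF assms(1) F(1) L, of "\<lambda>n. z n"])
      fix x y c assume xy: "x \<in> E" "y \<in> E" and c: "\<And>n. \<bar>F (z n) x - F (z n) y\<bar> \<le> c"
      have L0: "0 \<le> L" using L by (rule lipschitz_on_nonneg)
      show "dist (f x) (f y) \<le> c"
      proof (rule field_le_epsilon)
        fix e :: real assume "0 < e"
        then have "0 < e / (2 * (L + 1))" using L0 by simp
        moreover have "x \<in> closure T" using T(3) xy(1) by blast
        ultimately obtain t where t: "t \<in> T" "dist t x < e / (2 * (L + 1))"
          unfolding closure_approachable by blast
        obtain n where n: "t = from_nat_into T n" using from_nat_into_surj[OF T(1) t(1)] by metis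
        have "dist (f x) (f t) \<le> L * dist x t" using lipschitz_onD[OF L] xy t T(2) by blast
        also have "\<dots> \<le> (L + 1) * (e / (2 * (L + 1)))"
          using t L0 by (intro mult_mono) (auto simp: dist_commute)
        also have "\<dots> = e / 2" using L0 by (simp add: field_simps)
        finally have 1: "dist (f x) (z n) \<le> e / 2" by (simp add: z_def n)
        \<comment> \<open>With \<open>z n\<close> close to \<open>f x\<close>, the difference of the
          two distances to \<open>z n\<close> nearly equals \<open>dist (f x) (f y)\<close> in
          absolute value.\<close>
        have "\<bar>dist (f x) (z n) - dist (f y) (z n)\<bar> \<le> c" using c[of n] F(2) xy by simp
        then show "dist (f x) (f y) \<le> c + e"
          using 1 dist_triangle2[of "f x" "f y" "z n"] by linarith
      qed
    next
      \<comment> \<open>Statement (4) speaks of distinct points, so tuples with repetitions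
        contribute only \<open>N\<close>. As \<open>'k\<close> is finite, there are countably many
        tuples.\<close>
      let ?bad' = "\<lambda>\<iota>. (if inj (z \<circ> \<iota>) then ?bad (z \<circ> \<iota>) else {}) \<union> N (z \<circ> \<iota>)"
      have "negligible (?bad' \<iota>)" for \<iota>
        using that null_iff by (intro negligible_Un negN) auto
      then have "negligible (\<Union>\<iota> :: 'k \<Rightarrow> nat. ?bad' \<iota>)"
        by (intro negligible_countable_Union) auto
      moreover have "{x \<in> E. \<not> (\<exists>w. norm w = 1 \<and> (\<forall>n. \<exists>M. (F (z n) has_derivative M) (at x) \<and> M w = 0))}
          \<subseteq> (\<Union>\<iota> :: 'k \<Rightarrow> nat. ?bad' \<iota>)"
      proof (rule subsetI, rule ccontr)
        fix x
        assume x: "x \<in> {x \<in> E. \<not> (\<exists>w. norm w = 1 \<and>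
            (\<forall>n. \<exists>M. (F (z n) has_derivative M) (at x) \<and> M w = 0))}"
          and "x \<notin> (\<Union>\<iota> :: 'k \<Rightarrow> nat. ?bad' \<iota>)"
        then have good: "x \<in> E" "x \<notin> ?bad' \<iota>" for \<iota> by blast+
        have xN: "x \<notin> N (z \<circ> \<iota>)" for \<iota> using good(2)[of \<iota>] by blast
        \<comment> \<open>A constant tuple gives differentiability of the single function
          \<open>F (z n)\<close>, as \<open>N\<close> is defined for arbitrary tuples.\<close>
        have Dn: "(F (z n) has_derivative D (z n) x) (at x)" for n
          using D[OF xN[of "\<lambda>_. n"]] by simp
        have "\<exists>w. norm w = 1 \<and> (\<forall>n. D (z n) x w = 0)"
        proof (rule common_kernel_of_degenerate_tuples)
          show "linear (D (z n) x)" for n using Dn by (rule has_derivative_linear)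
          fix \<iota> :: "'k \<Rightarrow> nat" assume inj: "inj ((\<lambda>n. D (z n) x) \<circ> \<iota>)"
          \<comment> \<open>Equal points would have equal derivatives, so distinct derivatives come
            from distinct points and (4) applies.\<close>
          have "inj (z \<circ> \<iota>)"
          proof (rule injI)
            fix i j assume "(z \<circ> \<iota>) i = (z \<circ> \<iota>) j"
            then show "i = j" by (intro injD[OF inj]) simp
          qed
          then have "rank (ap_jacobian E (projection_at (z \<circ> \<iota>) f) x) < CARD('k)"
            using good(1) good(2)[of \<iota>] by auto
          then show "rank (matrix (\<lambda>v. \<chi> j. D (z (\<iota> j)) x v)) < CARD('k)"
            using jac(2)[OF good(1) xN] by simp
        qed
        then show False using x Dn by blast
      qed
      ultimately show "negligible {x \<in> E. \<not> (\<exists>w. norm w = 1 \<and>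
          (\<forall>n. \<exists>M. (F (z n) has_derivative M) (at x) \<and> M w = 0))}"
        by (rule negligible_subset)
    qed
  qed
  show ?thesis using 12 23 34 41 by blast
qed

end
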